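(* Let $T$ be a finite rooted tree whose reduction is not isomorphic (as a rooted tree) to any $T_{b,a}$ with $a,b\ge 1$. Then the plucking polynomial $Q(T)$ has a trapezoidal shape.
   Context: Trees are finite and grow up from the root. For a plane rooted tree $T$ the plucking polynomial $Q(T)=Q(T,q)$ is defined recursively: $Q(T)=1$ if $T$ is a single vertex; otherwise $Q(T,q)=\sum_{v}q^{r(T,v)}Q(T-v,q)$, the sum over all leaves $v$ of $T$ (vertices of degree $1$ other than the root), where $r(T,v)$ is the number of edges of $T$ to the right of the unique path joining $v$ to the root. It is known that $Q(T)$ does not depend on the plane embedding, so it is an invariant of rooted trees. A rooted tree is reduced if its root has degree different from $1$. The reduction of a rooted tree is obtained by cutting off its string, i.e. the maximal path going up from the root through vertices with exactly one upward edge; the new root is the upper end of this path. $T_{b,a}$ is the rooted tree obtained by gluing a path with $b$ edges and a path with $a$ edges at one end of each, this common vertex being the root (so $Q(T_{b,a})=\binom{b+a}{b,a}_q$ is a Gaussian polynomial). A polynomial $\sum_{i=0}^N c_iq^i$ of degree $N$ with nonnegative integer coefficients, $c_0>0$ and $c_i=c_{N-i}$ has a trapezoidal shape if for some $0\le j\le N/2$ one has $c_0<c_1<\dots<c_j=\dots=c_{N-j}>\dots>c_{N-1}>c_N$. *)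

theory Defs
  imports "HOL-Library.Multiset" "HOL-Computational_Algebra.Polynomial"
begin

section \<open>Rooted trees and plane rooted trees\<close>

text \<open>
  A finite rooted tree, up to isomorphism, is the multiset of the subtrees rooted at the upper
  neighbours of its root. Hence equality of type \<open>rtree\<close> is isomorphism of rooted trees.
  In a plane rooted tree these subtrees are listed from left to right.
\<close>

datatype rtree = RNode (branches: "rtree multiset")

datatype ptree = PNode "ptree list"

primrec underlying :: "ptree \<Rightarrow> rtree" where
  "underlying (PNode ts) = RNode (mset (map underlying ts))"

section \<open>The plucking polynomial\<close>

text \<open>
  A vertex is addressed by the list of (0-based) child indices along the path from the root to it.
\<close>

function vertices :: "ptree \<Rightarrow> nat list set" where
  "vertices (PNode ts) = insert [] (\<Union>i<length ts. (#) i ` vertices (ts ! i))"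
  by pat_completeness simp
termination
  by (relation "measure size") (auto simp: less_Suc_eq_le intro: size_list_estimation' nth_mem)

fun subtree_at :: "ptree \<Rightarrow> nat list \<Rightarrow> ptree" where
  "subtree_at t [] = t"
| "subtree_at (PNode ts) (i # v) = subtree_at (ts ! i) v"

text \<open>
  A vertex other than the root has exactly one edge going down, so it has degree 1 iff no edge
  goes up from it.
\<close>

definition leaves :: "ptree \<Rightarrow> nat list set" where
  "leaves t = {v \<in> vertices t. v \<noteq> [] \<and> subtree_at t v = PNode []}"

fun num_edges :: "ptree \<Rightarrow> nat" where
  "num_edges (PNode ts) = (\<Sum>t\<leftarrow>ts. Suc (num_edges t))"

text \<open>
  An edge to the right of the path from the root to \<open>v\<close> lies in, or leads up to, a subtree that
  branches off to the right of the path.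
\<close>

fun right_edges :: "ptree \<Rightarrow> nat list \<Rightarrow> nat" where
  "right_edges t [] = 0"
| "right_edges (PNode ts) (i # v) =
     right_edges (ts ! i) v + (\<Sum>t\<leftarrow>drop (Suc i) ts. Suc (num_edges t))"

text \<open>Only used for \<open>v\<close> a leaf; the first equation is a dummy.\<close>

fun delete_leaf :: "ptree \<Rightarrow> nat list \<Rightarrow> ptree" where
  "delete_leaf t [] = t"
| "delete_leaf (PNode ts) [i] = PNode (take i ts @ drop (Suc i) ts)"
| "delete_leaf (PNode ts) (i # v) = PNode (ts[i := delete_leaf (ts ! i) v])"

lemma num_edges_split:
  assumes "i < length ts"
  shows "num_edges (PNode ts) =
    num_edges (PNode (take i ts)) + Suc (num_edges (ts ! i)) + num_edges (PNode (drop (Suc i) ts))"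
proof -
  have "num_edges (PNode (take i ts @ ts ! i # drop (Suc i) ts)) =
    num_edges (PNode (take i ts)) + Suc (num_edges (ts ! i)) + num_edges (PNode (drop (Suc i) ts))"
    by simp
  then show ?thesis
    using assms by (simp only: id_take_nth_drop[symmetric])
qed

lemma num_edges_delete_leaf:
  assumes "v \<in> leaves t"
  shows "Suc (num_edges (delete_leaf t v)) = num_edges t"
proof -
  have "v \<in> vertices t" "v \<noteq> []" "subtree_at t v = PNode []"
    using assms by (auto simp: leaves_def)
  then show ?thesis
  proof (induction t v rule: delete_leaf.induct)
    case (2 ts i)
    then have "i < length ts" "ts ! i = PNode []"
      by auto
    then show ?case
      unfolding num_edges_split[OF \<open>i < length ts\<close>] by simp
  next
    case (3 ts i j w)
    then have i: "i < length ts" and "j # w \<in> vertices (ts ! i)"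
      by auto
    then have "Suc (num_edges (delete_leaf (ts ! i) (j # w))) = num_edges (ts ! i)"
      using 3 by simp
    with i show ?case
      unfolding num_edges_split[OF i] by (simp add: upd_conv_take_nth_drop)
  qed simp
qed

function plucking :: "ptree \<Rightarrow> int poly" where
  "plucking t =
     (if t = PNode [] then 1
      else (\<Sum>v\<in>leaves t. monom 1 (right_edges t v) * plucking (delete_leaf t v)))"
  by auto
termination
  by (relation "measure num_edges") (use num_edges_delete_leaf in \<open>force+\<close>)

declare plucking.simps [simp del]

section \<open>Reduction, and the trees \<open>T\<^sub>b\<^sub>,\<^sub>a\<close>\<close>

function reduction :: "rtree \<Rightarrow> rtree" where
  "reduction (RNode {#t#}) = reduction t"
| "reduction (RNode B) = RNode B" if "\<And>t. B \<noteq> {#t#}"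
proof -
  show P if "\<And>t. x = RNode {#t#} \<Longrightarrow> P" "\<And>B. \<lbrakk>\<And>t. B \<noteq> {#t#}; x = RNode B\<rbrakk> \<Longrightarrow> P" for P x
    using that rtree.exhaust by metis
qed blast+
termination by (relation "measure size") simp_all

primrec path_tree :: "nat \<Rightarrow> rtree" where
  "path_tree 0 = RNode {#}"
| "path_tree (Suc n) = RNode {#path_tree n#}"

definition glue :: "rtree \<Rightarrow> rtree \<Rightarrow> rtree" where
  "glue s t = RNode (branches s + branches t)"

definition two_paths :: "nat \<Rightarrow> nat \<Rightarrow> rtree" where
  "two_paths b a = glue (path_tree b) (path_tree a)"

section \<open>Trapezoidal shape\<close>

definition trapezoidal :: "int poly \<Rightarrow> bool" where
  "trapezoidal p \<longleftrightarrow>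
     (let N = degree p; c = coeff p in
      (\<forall>i. 0 \<le> c i) \<and> 0 < c 0 \<and> (\<forall>i\<le>N. c i = c (N - i)) \<and>
      (\<exists>j. 2 * j \<le> N \<and>
         (\<forall>i<j. c i < c (Suc i)) \<and>
         (\<forall>i\<in>{j..N - j}. c i = c j) \<and>
         (\<forall>i\<in>{N - j..<N}. c (Suc i) < c i)))"

end

theory Submission
  imports Defs "HOL-Library.Poly_Mapping" "HOL-Computational_Algebra.Polynomial_Factorial"
begin

text \<open>
  A symmetric unimodal polynomial of degree \<open>N\<close> is the character of a representation of \<open>sl\<^sub>2\<close>; it jumps
  at \<open>k \<le> N / 2\<close> (its \<open>k\<close>-th coefficient exceeds the previous one) iff the irreducible summand of highest
  weight \<open>N - 2 k\<close> occurs. Trapezoidal shape means that the jumps form an initial segment. By the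
  Clebsch--Gordan rule, \<open>i\<close> and \<open>j\<close> in the jump sets of \<open>p\<close> and \<open>r\<close> contribute the jumps from \<open>i + j\<close> to
  \<open>i + j + min (deg p - 2 i) (deg r - 2 j)\<close> of \<open>p r\<close>. Hence a product of two nonconstant
  polynomials is trapezoidal as soon as each factor is trapezoidal or has no two consecutive
  non-jumps up to the middle.

  The hook formula for \<open>Q(T)\<close> shows that \<open>Q(T)\<close> is a product of Gaussian polynomials, and that it has at
  least two nonconstant factors unless \<open>T\<close> is a path or reduces to some \<open>T\<^sub>b\<^sub>,\<^sub>a\<close>. So it remains to see that
  Gaussian polynomials have one of the two properties. The coefficients of the Gaussian polynomial with
  parameters \<open>a, b\<close> count the monomials of degree \<open>a\<close> and weight \<open>i\<close> in \<open>x\<^sub>0, \<dots>, x\<^sub>b\<close>, on which \<open>sl\<^sub>2\<close> acts by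
  derivations. The lowering derivation \<open>x\<^sub>j \<mapsto> x\<^sub>j\<^sub>-\<^sub>1\<close> is onto in the lower half, so jumps correspond
  to nonzero elements of its kernel. Multiplying such elements shows that jumps of the polynomials for \<open>(a, b)\<close> and
  \<open>(a', b)\<close> add up to jumps for \<open>(a + a', b)\<close>, and the symmetry in \<open>a\<close> and \<open>b\<close> reduces everything to five
  small cases.
\<close>

section \<open>Jumps of symmetric unimodal polynomials\<close>

definition zcoeff :: "int poly \<Rightarrow> int \<Rightarrow> int" where
  "zcoeff p k = (if k < 0 then 0 else coeff p (nat k))"

definition sym_unimodal :: "int poly \<Rightarrow> bool" where
  "sym_unimodal p \<longleftrightarrow> 0 < coeff p 0 \<and>
     (\<forall>k. zcoeff p (int (degree p) - k) = zcoeff p k) \<and>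
     (\<forall>x y. y \<le> x \<longrightarrow> x + y \<le> int (degree p) \<longrightarrow> zcoeff p y \<le> zcoeff p x)"

definition jump :: "int poly \<Rightarrow> int \<Rightarrow> bool" where
  "jump p k \<longleftrightarrow> 2 * k \<le> int (degree p) \<and> zcoeff p (k - 1) < zcoeff p k"

definition jumps_closed :: "int poly \<Rightarrow> bool" where
  "jumps_closed p \<longleftrightarrow> sym_unimodal p \<and> (\<forall>k>0. jump p k \<longrightarrow> jump p (k - 1))"

definition jumps_dense :: "int poly \<Rightarrow> bool" where
  "jumps_dense p \<longleftrightarrow> sym_unimodal p \<and>
     (\<forall>k\<ge>0. 2 * (k + 1) \<le> int (degree p) \<longrightarrow> jump p k \<or> jump p (k + 1))"

lemma zcoeff_neg [simp]: "k < 0 \<Longrightarrow> zcoeff p k = 0"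
  by (simp add: zcoeff_def)

lemma zcoeff_of_nat [simp]: "zcoeff p (int n) = coeff p n"
  by (simp add: zcoeff_def)

lemma zcoeff_beyond: "int (degree p) < k \<Longrightarrow> zcoeff p k = 0"
  by (auto simp: zcoeff_def intro!: coeff_eq_0)

lemma zcoeff_mult: "zcoeff (p * r) k = (\<Sum>i\<in>{0..int (degree p)}. zcoeff p i * zcoeff r (k - i))"
proof (cases "k < 0")
  case False
  then obtain n where k: "k = int n"
    using nonneg_int_cases by (metis not_less)
  have "zcoeff (p * r) k = (\<Sum>i\<le>n. coeff p i * coeff r (n - i))"
    by (simp add: k coeff_mult)
  also have "\<dots> = (\<Sum>i\<le>n. zcoeff p (int i) * zcoeff r (k - int i))"
    by (intro sum.cong refl) (auto simp: k zcoeff_def nat_diff_distrib)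
  also have "\<dots> = (\<Sum>i\<le>n + degree p. zcoeff p (int i) * zcoeff r (k - int i))"
    by (intro sum.mono_neutral_left) (auto simp: k)
  also have "\<dots> = (\<Sum>i\<le>degree p. zcoeff p (int i) * zcoeff r (k - int i))"
    by (intro sum.mono_neutral_right) (auto simp: coeff_eq_0)
  also have "\<dots> = (\<Sum>i\<in>int ` {..degree p}. zcoeff p i * zcoeff r (k - i))"
    by (simp add: sum.reindex)
  also have "int ` {..degree p} = {0..int (degree p)}"
    by (metis atMost_atLeast0 image_int_atLeastAtMost of_nat_0)
  finally show ?thesis .
qed (simp add: sum.neutral)

lemma jump_nonneg: "jump p k \<Longrightarrow> 0 \<le> k"
  by (rule ccontr) (simp add: jump_def)

lemma jump_0: "sym_unimodal p \<Longrightarrow> jump p 0"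
  by (simp add: jump_def sym_unimodal_def zcoeff_def)

lemma sym_unimodal_nonneg: "sym_unimodal p \<Longrightarrow> 0 \<le> zcoeff p k"
proof -
  assume "sym_unimodal p"
  moreover define y where "y = - 1 - \<bar>k\<bar>"
  moreover have "y \<le> k" "k + y \<le> int (degree p)"
    unfolding y_def by linarith+
  ultimately have "zcoeff p y \<le> zcoeff p k"
    unfolding sym_unimodal_def by blast
  then show ?thesis by (simp add: y_def)
qed

lemma sym_unimodal_mono:
  "sym_unimodal p \<Longrightarrow> y \<le> x \<Longrightarrow> x + y \<le> int (degree p) \<Longrightarrow> zcoeff p y \<le> zcoeff p x"
  by (simp add: sym_unimodal_def)

lemma sym_unimodal_sym: "sym_unimodal p \<Longrightarrow> zcoeff p (int (degree p) - k) = zcoeff p k"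
  by (simp add: sym_unimodal_def)

lemma sym_unimodalI:
  assumes pos: "0 < coeff p 0"
    and sym: "\<And>k. zcoeff p (int (degree p) - k) = zcoeff p k"
    and step: "\<And>k. 2 * k \<le> int (degree p) \<Longrightarrow> zcoeff p (k - 1) \<le> zcoeff p k"
  shows "sym_unimodal p"
proof -
  have half: "zcoeff p y \<le> zcoeff p x" if "y \<le> x" "2 * x \<le> int (degree p)" for x y
    using that
  proof (induction x rule: int_ge_induct)
    case (step i)
    then have "zcoeff p (i + 1 - 1) \<le> zcoeff p (i + 1)" by (intro assms) auto
    with step show ?case by simp
  qed simp
  have "zcoeff p y \<le> zcoeff p x" if "y \<le> x" "x + y \<le> int (degree p)" for x y
  proof (cases "2 * x \<le> int (degree p)")
    case False
    then have "zcoeff p y \<le> zcoeff p (int (degree p) - x)"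
      using that by (intro half) auto
    then show ?thesis by (simp add: sym)
  qed (use that half in auto)
  then show ?thesis
    using pos sym by (simp add: sym_unimodal_def)
qed

lemma zcoeff_less_iff_jump:
  assumes "sym_unimodal p" "y \<le> x" "2 * x \<le> int (degree p)"
  shows "zcoeff p y < zcoeff p x \<longleftrightarrow> (\<exists>j. y < j \<and> j \<le> x \<and> jump p j)"
  using assms(2,3)
proof (induction x rule: int_ge_induct)
  case (step i)
  have le: "zcoeff p i \<le> zcoeff p (i + 1)" "zcoeff p y \<le> zcoeff p i"
    using step.prems step.hyps by (auto intro!: sym_unimodal_mono[OF assms(1)])
  have "jump p (i + 1) \<longleftrightarrow> zcoeff p i < zcoeff p (i + 1)"
    using step.prems by (simp add: jump_def)
  then have "zcoeff p y < zcoeff p (i + 1) \<longleftrightarrow> zcoeff p y < zcoeff p i \<or> jump p (i + 1)"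
    using le by auto
  also have "\<dots> \<longleftrightarrow> (\<exists>j. y < j \<and> j \<le> i + 1 \<and> jump p j)"
  proof -
    have "j \<le> i + 1 \<longleftrightarrow> j \<le> i \<or> j = i + 1" for j
      by arith
    then show ?thesis
      using step.IH step.prems step.hyps by (auto intro: exI[of _ "i + 1"])
  qed
  finally show ?case .
qed simp

lemma zcoeff_less_iff_jump':
  assumes "sym_unimodal p" "y < x" "x + y < int (degree p)"
  shows "zcoeff p y < zcoeff p x \<longleftrightarrow> (\<exists>j. y < j \<and> j \<le> x \<and> j \<le> int (degree p) - x \<and> jump p j)"
proof -
  have "zcoeff p x = zcoeff p (min x (int (degree p) - x))"
    using sym_unimodal_sym[OF assms(1)] by (simp add: min_def)
  moreover have "y \<le> min x (int (degree p) - x)" "2 * min x (int (degree p) - x) \<le> int (degree p)"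
    using assms by (auto simp: min_def)
  ultimately show ?thesis
    using zcoeff_less_iff_jump[OF assms(1)] by auto
qed

text \<open>
  The differences of the coefficients of \<open>p\<close> are antisymmetric under \<open>i \<mapsto> degree p + 1 - i\<close>;
  pairing the terms of the convolution accordingly makes all of them nonnegative.
\<close>

lemma zcoeff_mult_diff:
  assumes "sym_unimodal p"
  shows "2 * (zcoeff (p * r) k - zcoeff (p * r) (k - 1)) =
    (\<Sum>i\<in>{0..int (degree p) + 1}. (zcoeff p i - zcoeff p (i - 1)) *
       (zcoeff r (k - i) - zcoeff r (k - (int (degree p) + 1 - i))))"
proof -
  define N where "N = int (degree p)"
  define d where "d i = zcoeff p i - zcoeff p (i - 1)" for i
  have anti: "d (N + 1 - i) = - d i" for i
    using sym_unimodal_sym[OF assms, of i] sym_unimodal_sym[OF assms, of "i - 1"]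
    by (simp add: d_def N_def algebra_simps)
  have "zcoeff (p * r) k = (\<Sum>i\<in>{0..N + 1}. zcoeff p i * zcoeff r (k - i))"
    unfolding zcoeff_mult N_def by (rule sum.mono_neutral_left) (auto simp: zcoeff_beyond)
  moreover have "zcoeff (p * r) (k - 1) = (\<Sum>i\<in>{0..N + 1}. zcoeff p (i - 1) * zcoeff r (k - i))"
  proof -
    have "zcoeff (p * r) (k - 1) = (\<Sum>i\<in>{0 + 1..N + 1}. zcoeff p (i - 1) * zcoeff r (k - i))"
      unfolding zcoeff_mult N_def
      by (rule sum.reindex_bij_witness[of _ "\<lambda>i. i - 1" "\<lambda>i. i + 1"]) (auto simp: algebra_simps)
    also have "\<dots> = (\<Sum>i\<in>{0..N + 1}. zcoeff p (i - 1) * zcoeff r (k - i))"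
      by (rule sum.mono_neutral_left) auto
    finally show ?thesis .
  qed
  ultimately have eq: "zcoeff (p * r) k - zcoeff (p * r) (k - 1) = (\<Sum>i\<in>{0..N + 1}. d i * zcoeff r (k - i))"
    by (simp add: d_def sum_subtractf algebra_simps)
  have "(\<Sum>i\<in>{0..N + 1}. d i * zcoeff r (k - i)) =
      (\<Sum>i\<in>{0..N + 1}. d (N + 1 - i) * zcoeff r (k - (N + 1 - i)))"
    by (rule sum.reindex_bij_witness[of _ "\<lambda>i. N + 1 - i" "\<lambda>i. N + 1 - i"]) auto
  then show ?thesis
    unfolding d_def[symmetric] N_def[symmetric] using eq
    by (simp only: anti minus_mult_left[symmetric] sum_negf right_diff_distrib sum_subtractf)
qed

lemma sum_pos_iff:
  fixes f :: "'a \<Rightarrow> int"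
  assumes "finite A" "\<And>x. x \<in> A \<Longrightarrow> 0 \<le> f x"
  shows "0 < sum f A \<longleftrightarrow> (\<exists>x\<in>A. 0 < f x)"
  using sum_nonneg_eq_0_iff[OF assms(1), of f] assms(2) sum_nonneg[of A f]
  by (metis less_le)

context
  fixes p r :: "int poly"
  assumes p: "sym_unimodal p" and r: "sym_unimodal r"
begin

private lemma degree_pr: "degree (p * r) = degree p + degree r"
  using p r by (intro degree_mult_eq) (auto simp: sym_unimodal_def)

private definition "term k i = (zcoeff p i - zcoeff p (i - 1)) *
       (zcoeff r (k - i) - zcoeff r (k - (int (degree p) + 1 - i)))"

private lemma term_sym: "term k (int (degree p) + 1 - i) = term k i"
proof -
  have "zcoeff p (int (degree p) + 1 - i) = zcoeff p (i - 1)" "zcoeff p (int (degree p) + 1 - i - 1) = zcoeff p i"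
    using sym_unimodal_sym[OF p, of i] sym_unimodal_sym[OF p, of "i - 1"] by (simp_all add: algebra_simps)
  then show ?thesis
    unfolding term_def by (simp add: left_diff_distrib right_diff_distrib)
qed

private lemma term_lower:
  assumes "2 * k \<le> int (degree p + degree r)" "2 * i \<le> int (degree p)"
  shows "0 \<le> term k i"
    and "0 < term k i \<longleftrightarrow> jump p i \<and> (\<exists>j. jump r j \<and> i + j \<le> k \<and>
           k \<le> int (degree p) - i + j \<and> k \<le> int (degree r) - j + i)"
proof -
  have 1: "zcoeff p (i - 1) \<le> zcoeff p i"
    using assms by (intro sym_unimodal_mono[OF p]) auto
  have 2: "zcoeff r (k - (int (degree p) + 1 - i)) \<le> zcoeff r (k - i)"
    using assms by (intro sym_unimodal_mono[OF r]) auto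
  show "0 \<le> term k i"
    using 1 2 by (simp add: term_def)
  have "0 < term k i \<longleftrightarrow> zcoeff p (i - 1) < zcoeff p i \<and>
      zcoeff r (k - (int (degree p) + 1 - i)) < zcoeff r (k - i)"
    using 1 2 by (auto simp: term_def zero_less_mult_iff)
  also have "zcoeff p (i - 1) < zcoeff p i \<longleftrightarrow> jump p i"
    using assms by (simp add: jump_def)
  also have "zcoeff r (k - (int (degree p) + 1 - i)) < zcoeff r (k - i) \<longleftrightarrow>
      (\<exists>j. jump r j \<and> i + j \<le> k \<and> k \<le> int (degree p) - i + j \<and> k \<le> int (degree r) - j + i)"
    using assms by (subst zcoeff_less_iff_jump'[OF r]) (auto intro!: ex_cong1)
  finally show "0 < term k i \<longleftrightarrow> jump p i \<and> (\<exists>j. jump r j \<and> i + j \<le> k \<and>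
           k \<le> int (degree p) - i + j \<and> k \<le> int (degree r) - j + i)" .
qed

private lemma half_cases:
  "2 * i \<le> int (degree p) \<or> 2 * i = int (degree p) + 1 \<or> 2 * (int (degree p) + 1 - i) \<le> int (degree p)"
  by arith

private lemma term_nonneg:
  assumes "2 * k \<le> int (degree p + degree r)"
  shows "0 \<le> term k i"
proof -
  consider "2 * i \<le> int (degree p)" | "2 * i = int (degree p) + 1" | "2 * (int (degree p) + 1 - i) \<le> int (degree p)"
    using half_cases by blast
  then show ?thesis
  proof cases
    case 2
    then have "int (degree p) + 1 - i = i" by simp
    then show ?thesis unfolding term_def by simp
  qed (use term_lower(1)[OF assms] term_sym in metis)+
qed

lemma jump_mult_iff:
  "jump (p * r) k \<longleftrightarrow> (\<exists>i j. jump p i \<and> jump r j \<and> i + j \<le> k \<and>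
     k \<le> int (degree p) - i + j \<and> k \<le> int (degree r) - j + i)" (is "_ \<longleftrightarrow> ?R")
proof (cases "2 * k \<le> int (degree p + degree r)")
  case True
  have "jump (p * r) k \<longleftrightarrow> 0 < 2 * (zcoeff (p * r) k - zcoeff (p * r) (k - 1))"
    using True by (simp add: jump_def degree_pr)
  also have "\<dots> \<longleftrightarrow> (\<exists>i\<in>{0..int (degree p) + 1}. 0 < term k i)"
    unfolding zcoeff_mult_diff[OF p] term_def[symmetric]
    by (rule sum_pos_iff) (use term_nonneg[OF True] in auto)
  also have "\<dots> \<longleftrightarrow> ?R"
  proof
    assume "\<exists>i\<in>{0..int (degree p) + 1}. 0 < term k i"
    then obtain i where i: "0 < term k i" by blast
    consider "2 * i \<le> int (degree p)" | "2 * i = int (degree p) + 1" | "2 * (int (degree p) + 1 - i) \<le> int (degree p)"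
      using half_cases by blast
    then obtain i' where "2 * i' \<le> int (degree p)" "0 < term k i'"
    proof cases
      case 2
      then have "int (degree p) + 1 - i = i" by simp
      then have "term k i = 0" unfolding term_def by simp
      with i show ?thesis by simp
    qed (use i term_sym in metis)+
    then show ?R using term_lower(2)[OF True] by metis
  next
    assume ?R
    then obtain i where i: "jump p i \<and> (\<exists>j. jump r j \<and> i + j \<le> k \<and>
           k \<le> int (degree p) - i + j \<and> k \<le> int (degree r) - j + i)" by blast
    then have 2: "2 * i \<le> int (degree p)" "0 \<le> i" using jump_nonneg by (auto simp: jump_def)
    with i have "0 < term k i" using term_lower(2)[OF True] by blast
    with 2 show "\<exists>i\<in>{0..int (degree p) + 1}. 0 < term k i" by force
  qed
  finally show ?thesis .
qed (auto simp: jump_def degree_pr)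

lemma sym_unimodal_mult: "sym_unimodal (p * r)"
proof (rule sym_unimodalI)
  show "0 < coeff (p * r) 0"
    using p r by (simp add: coeff_mult sym_unimodal_def)
next
  fix k
  show "zcoeff (p * r) (int (degree (p * r)) - k) = zcoeff (p * r) k"
    unfolding zcoeff_mult degree_pr
  proof (rule sum.reindex_bij_witness[of _ "\<lambda>i. int (degree p) - i" "\<lambda>i. int (degree p) - i"])
    fix i
    show "zcoeff p (int (degree p) - i) * zcoeff r (k - (int (degree p) - i)) =
        zcoeff p i * zcoeff r (int (degree p + degree r) - k - i)"
      using sym_unimodal_sym[OF p, of i] sym_unimodal_sym[OF r, of "k - (int (degree p) - i)"]
      by (simp add: algebra_simps)
  qed auto
next
  fix k
  assume "2 * k \<le> int (degree (p * r))"
  then have "0 \<le> 2 * (zcoeff (p * r) k - zcoeff (p * r) (k - 1))"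
    unfolding zcoeff_mult_diff[OF p] term_def[symmetric]
    by (intro sum_nonneg term_nonneg) (simp add: degree_pr)
  then show "zcoeff (p * r) (k - 1) \<le> zcoeff (p * r) k" by simp
qed

lemma jumps_closed_mult:
  assumes "jumps_closed p" "degree r \<le> degree p"
  shows "jumps_closed (p * r)"
proof -
  have dn: "jump p i" if "jump p j" "0 \<le> i" "i \<le> j" for i j
    using that(3,1,2)
  proof (induction j rule: int_ge_induct)
    case (step j)
    then have "jump p (j + 1 - 1)"
      using assms(1) unfolding jumps_closed_def by (metis zle_add1_eq_le order_trans)
    with step show ?case by simp
  qed
  have "jump (p * r) (k - 1)" if k: "k > 0" "jump (p * r) k" for k
  proof -
    obtain i j where ij: "jump p i" "jump r j" "i + j \<le> k"
      "k \<le> int (degree p) - i + j" "k \<le> int (degree r) - j + i"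
      using k(2) jump_mult_iff by blast
    have "0 \<le> i" "0 \<le> j" using ij jump_nonneg by auto
    have 2: "2 * k \<le> int (degree p) + int (degree r)"
      using k by (simp add: jump_def degree_pr)
    define i' where "i' = max 0 (k - 1 - int (degree r))"
    have "jump p i'"
      using ij \<open>0 \<le> i\<close> \<open>0 \<le> j\<close> by (intro dn[OF ij(1)]) (auto simp: i'_def)
    then show ?thesis
      unfolding jump_mult_iff using jump_0[OF r] assms(2) k(1) 2
      by (intro exI[of _ i'] exI[of _ 0]) (auto simp: i'_def)
  qed
  then show ?thesis
    using sym_unimodal_mult by (simp add: jumps_closed_def)
qed

lemma jumps_dense_mult:
  assumes "jumps_dense p" "degree r \<le> degree p" "0 < degree r"
  shows "jumps_closed (p * r)"
proof -
  have *: "jump (p * r) k" if k: "0 \<le> k" "2 * (k + 1) \<le> int (degree p) + int (degree r)" for k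
  proof -
    obtain i where i: "jump p i" "0 \<le> i" "k - int (degree r) \<le> i" "i \<le> k" "k \<le> int (degree p) - i"
    proof (cases "k \<le> int (degree r)")
      case True
      then show ?thesis using that[of 0] k assms jump_0[OF p] by auto
    next
      case False
      define l where "l = k - int (degree r)"
      have "0 \<le> l" "2 * (l + 1) \<le> int (degree p)"
        using False k assms(2) by (auto simp: l_def)
      then have "jump p l \<or> jump p (l + 1)"
        using assms(1) by (auto simp: jumps_dense_def)
      then show ?thesis
        using that[of l] that[of "l + 1"] False k assms by (auto simp: l_def)
    qed
    then show ?thesis
      unfolding jump_mult_iff using jump_0[OF r] by (intro exI[of _ i] exI[of _ 0]) auto
  qed
  have "jump (p * r) (k - 1)" if "k > 0" "jump (p * r) k" for k
    by (rule *) (use that in \<open>auto simp: jump_def degree_pr\<close>)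
  then show ?thesis
    using sym_unimodal_mult by (simp add: jumps_closed_def)
qed

end

lemma jumps_closed_mult_pos_degree:
  assumes "jumps_closed p \<or> jumps_dense p" "jumps_closed r \<or> jumps_dense r" "0 < degree p" "0 < degree r"
  shows "jumps_closed (p * r)"
proof -
  have u: "sym_unimodal p" "sym_unimodal r"
    using assms by (auto simp: jumps_closed_def jumps_dense_def)
  show ?thesis
  proof (cases "degree r \<le> degree p")
    case True
    then show ?thesis
      using assms jumps_closed_mult[OF u] jumps_dense_mult[OF u] by blast
  next
    case False
    then have "jumps_closed (r * p)"
      using assms jumps_closed_mult[OF u(2,1)] jumps_dense_mult[OF u(2,1)] by fastforce
    then show ?thesis
      by (simp add: mult.commute)
  qed
qed

lemma jumps_closed_imp_trapezoidal:
  assumes "jumps_closed p"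
  shows "trapezoidal p"
proof -
  define N where "N = degree p"
  have u: "sym_unimodal p" and cl: "\<And>k. 0 < k \<Longrightarrow> jump p k \<Longrightarrow> jump p (k - 1)"
    using assms by (auto simp: jumps_closed_def)
  have sym: "coeff p (N - i) = coeff p i" if "i \<le> N" for i
    using sym_unimodal_sym[OF u, of "int i"] that by (simp add: N_def zcoeff_def nat_diff_distrib)
  define j where "j = (GREATEST j. jump p (int j))"
  have bound: "n \<le> N" if "jump p (int n)" for n
    using that by (simp add: jump_def N_def)
  have "jump p (int 0)" using jump_0[OF u] by simp
  then have j: "jump p (int j)" unfolding j_def
    using bound by (rule GreatestI_nat)
  have max: "n \<le> j" if "jump p (int n)" for n
    unfolding j_def using that bound by (rule Greatest_le_nat)
  have dn: "jump p (int i)" if "i \<le> j" for i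
    using that j
  proof (induction rule: dec_induct)
    case (step n)
    then show ?case using cl[of "int (Suc n)"] by simp
  qed
  have 2: "2 * j \<le> N" using j by (simp add: jump_def N_def)
  have up: "coeff p i < coeff p (Suc i)" if "i < j" for i
    using dn[of "Suc i"] that zcoeff_of_nat[of p i] zcoeff_of_nat[of p "Suc i"] unfolding jump_def by simp
  have flat: "coeff p i = coeff p j" if "j \<le> i" "2 * i \<le> N" for i
  proof -
    have "\<not> zcoeff p (int j) < zcoeff p (int i)"
    proof
      assume "zcoeff p (int j) < zcoeff p (int i)"
      moreover have "2 * int i \<le> int (degree p)" "int j \<le> int i"
        using that by (simp_all add: N_def)
      ultimately obtain l where "int j < l" "jump p l"
        using zcoeff_less_iff_jump[OF u, of "int j" "int i"] by blast
      then show False using max[of "nat l"] by simp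
    qed
    moreover have "zcoeff p (int j) \<le> zcoeff p (int i)"
      using that by (intro sym_unimodal_mono[OF u]) (auto simp: N_def)
    ultimately show ?thesis by simp
  qed
  have plateau: "coeff p i = coeff p j" if "i \<in> {j..N - j}" for i
  proof (cases "2 * i \<le> N")
    case True
    then show ?thesis using that by (intro flat) simp_all
  next
    case False
    then have "coeff p (N - i) = coeff p j"
      using that 2 by (intro flat) auto
    then show ?thesis using sym[of i] that by auto
  qed
  have down: "coeff p (Suc i) < coeff p i" if "i \<in> {N - j..<N}" for i
  proof -
    have "coeff p (N - Suc i) < coeff p (Suc (N - Suc i))"
      using that 2 by (intro up) auto
    also have "Suc (N - Suc i) = N - i" using that by auto
    finally show ?thesis using sym[of i] sym[of "Suc i"] that by simp
  qed
  have nonneg: "0 \<le> coeff p i" for i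
    using sym_unimodal_nonneg[OF u, of "int i"] by simp
  have "0 < coeff p 0" using u by (simp add: sym_unimodal_def)
  then show ?thesis
    unfolding trapezoidal_def Let_def N_def[symmetric]
    by (intro conjI exI[of _ j] allI impI ballI nonneg 2 up plateau down sym[symmetric])
qed

section \<open>Gaussian polynomials\<close>

definition qint :: "nat \<Rightarrow> int poly" where "qint n = (\<Sum>i<n. monom 1 i)"

primrec qfact :: "nat \<Rightarrow> int poly" where
  "qfact 0 = 1"
| "qfact (Suc n) = qint (Suc n) * qfact n"

fun gauss :: "nat \<Rightarrow> nat \<Rightarrow> int poly" where
  "gauss 0 b = 1"
| "gauss (Suc a) 0 = 1"
| "gauss (Suc a) (Suc b) = gauss (Suc a) b + monom 1 (Suc b) * gauss a (Suc b)"

lemma gauss_0_right [simp]: "gauss a 0 = 1"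
  by (cases a) auto

lemma coeff_qint: "coeff (qint n) i = (if i < n then 1 else 0)"
  by (simp add: qint_def coeff_sum)

lemma qint_0 [simp]: "qint 0 = 0" and qint_1 [simp]: "qint (Suc 0) = 1"
  by (simp_all add: qint_def)

lemma qint_add: "qint (m + n) = qint m + monom 1 m * qint n"
  by (rule poly_eqI) (auto simp: coeff_qint coeff_monom_mult)

lemma qint_neq_0 [simp]: "qint (Suc n) \<noteq> 0"
proof
  assume "qint (Suc n) = 0"
  then have "coeff (qint (Suc n)) 0 = 0" by simp
  then show False by (simp add: coeff_qint)
qed

lemma qfact_neq_0 [simp]: "qfact n \<noteq> 0"
  by (induction n) auto

lemma degree_qint [simp]: "degree (qint (Suc n)) = n"
  by (intro antisym degree_le le_degree) (auto simp: coeff_qint)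

lemma reflect_qint [simp]: "reflect_poly (qint (Suc n)) = qint (Suc n)"
  by (rule poly_eqI) (auto simp: coeff_reflect_poly coeff_qint)

lemma reflect_qfact [simp]: "reflect_poly (qfact n) = qfact n"
  by (induction n) (auto simp: reflect_poly_mult)

lemma gauss_qfact: "gauss a b * qfact a * qfact b = qfact (a + b)"
proof (induction a b rule: gauss.induct)
  case (3 a b)
  have "gauss (Suc a) (Suc b) * qfact (Suc a) * qfact (Suc b) =
      qint (Suc b) * (gauss (Suc a) b * qfact (Suc a) * qfact b) +
      monom 1 (Suc b) * qint (Suc a) * (gauss a (Suc b) * qfact a * qfact (Suc b))"
    by (simp add: algebra_simps)
  also have "\<dots> = (qint (Suc b) + monom 1 (Suc b) * qint (Suc a)) * qfact (Suc (a + b))"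
    unfolding "3.IH" by (simp add: distrib_right)
  also have "qint (Suc b) + monom 1 (Suc b) * qint (Suc a) = qint (Suc (Suc (a + b)))"
    using qint_add[of "Suc b" "Suc a"] by (simp add: add.commute)
  finally show ?case by simp
qed simp_all

lemma gauss_eqI:
  assumes "p * qfact a * qfact b = qfact (a + b)"
  shows "gauss a b = p"
proof -
  have "gauss a b * (qfact a * qfact b) = p * (qfact a * qfact b)"
    using assms gauss_qfact[of a b] by (simp add: mult.assoc)
  then show ?thesis by simp
qed

lemma gauss_commute: "gauss a b = gauss b a"
  by (rule gauss_eqI) (use gauss_qfact[of b a] in \<open>simp add: ac_simps\<close>)

lemma gauss_1_right: "gauss a (Suc 0) = qint (Suc a)"
  by (rule gauss_eqI) simp

lemma coeff_0_gauss [simp]: "coeff (gauss a b) 0 = 1"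
  by (induction a b rule: gauss.induct) (auto simp: coeff_mult)

lemma gauss_neq_0 [simp]: "gauss a b \<noteq> 0"
  using coeff_0_gauss[of a b] by fastforce

lemma degree_gauss [simp]: "degree (gauss a b) = a * b"
proof -
  have "degree (qfact (a + b)) = a * b + degree (qfact a) + degree (qfact b)"
    by (induction b) (simp_all add: degree_mult_eq)
  also have "degree (qfact (a + b)) = degree (gauss a b) + degree (qfact a) + degree (qfact b)"
    unfolding gauss_qfact[of a b, symmetric] by (simp add: degree_mult_eq)
  finally show ?thesis by simp
qed

lemma coeff_gauss_sym:
  assumes "i \<le> a * b"
  shows "coeff (gauss a b) (a * b - i) = coeff (gauss a b) i"
proof -
  have "reflect_poly (gauss a b * qfact a * qfact b) = reflect_poly (qfact (a + b))"
    by (simp only: gauss_qfact)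
  then have "gauss a b = reflect_poly (gauss a b)"
    by (intro gauss_eqI) (simp add: reflect_poly_mult)
  then have "coeff (gauss a b) i = coeff (reflect_poly (gauss a b)) i"
    by simp
  with assms show ?thesis
    by (simp add: coeff_reflect_poly)
qed

lemma zcoeff_gauss_sym:
  "zcoeff (gauss a b) (int (degree (gauss a b)) - k) = zcoeff (gauss a b) k"
proof (cases "0 \<le> k \<and> k \<le> int (a * b)")
  case True
  then obtain n where k: "k = int n" "n \<le> a * b"
    using nonneg_int_cases by (metis of_nat_le_iff)
  then have "int (degree (gauss a b)) - k = int (a * b - n)"
    by (simp add: of_nat_diff)
  then show ?thesis
    using coeff_gauss_sym[OF k(2)] k(1) by (simp only: zcoeff_of_nat)
next
  case False
  then show ?thesis
    using zcoeff_beyond[of "gauss a b"] by force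
qed

lemma sym_unimodal_qint: "sym_unimodal (qint (Suc n))"
  by (rule sym_unimodalI) (auto simp: zcoeff_def coeff_qint)

lemma jumps_closed_qint: "jumps_closed (qint (Suc n))"
  using sym_unimodal_qint by (auto simp: jumps_closed_def jump_def zcoeff_def coeff_qint split: if_splits)

section \<open>The hook formula for the plucking polynomial\<close>

fun hooks :: "ptree \<Rightarrow> int poly" where
  "hooks (PNode ts) = (\<Prod>t\<leftarrow>ts. qint (Suc (num_edges t)) * hooks t)"

lemma hooks_neq_0 [simp]: "hooks t \<noteq> 0"
  by (induction t rule: hooks.induct) (auto simp: prod_list_zero_iff)

lemma finite_vertices: "finite (vertices t)"
  by (induction t rule: vertices.induct) auto

lemma finite_leaves: "finite (leaves t)"
  using finite_vertices by (simp add: leaves_def)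

lemma num_edges_eq_0_iff: "num_edges t = 0 \<longleftrightarrow> t = PNode []"
  by (cases t) (auto simp: sum_list_eq_0_iff split: list.splits)

definition tips :: "ptree \<Rightarrow> nat list set" where
  "tips t = (if t = PNode [] then {[]} else leaves t)"

lemma finite_tips: "finite (tips t)"
  by (simp add: tips_def finite_leaves)

lemma tips_altdef: "tips t = {v \<in> vertices t. subtree_at t v = PNode []}"
  by (cases t) (auto simp: tips_def leaves_def)

lemma leaves_PNode: "leaves (PNode ts) = (\<Union>i<length ts. (#) i ` tips (ts ! i))"
  by (auto simp: leaves_def tips_altdef)

lemma delete_leaf_Cons:
  "v \<noteq> [] \<Longrightarrow> delete_leaf (PNode ts) (i # v) = PNode (ts[i := delete_leaf (ts ! i) v])"
  by (cases v) auto

lemma to_fract_sum: "to_fract (sum f A) = (\<Sum>x\<in>A. to_fract (f x))"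
  by (induction A rule: infinite_finite_induct) auto

lemma qint_rest_sum:
  "(\<Sum>i<length ts. monom 1 (\<Sum>t\<leftarrow>drop (Suc i) ts. Suc (num_edges t)) * qint (Suc (num_edges (ts ! i))))
     = qint (num_edges (PNode ts))"
proof (induction ts)
  case (Cons t ts)
  have "qint (num_edges (PNode (t # ts))) =
      qint (num_edges (PNode ts)) + monom 1 (num_edges (PNode ts)) * qint (Suc (num_edges t))"
    using qint_add[of "num_edges (PNode ts)" "Suc (num_edges t)"] by (simp add: add.commute)
  then show ?case
    using Cons by (simp add: sum.lessThan_Suc_shift add.commute del: sum.lessThan_Suc)
qed simp

definition hook_ratio :: "ptree \<Rightarrow> nat list \<Rightarrow> int poly fract" where
  "hook_ratio t v = to_fract (hooks t) / to_fract (hooks (delete_leaf t v))"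

lemma hooks_split:
  assumes "i < length ts"
  shows "hooks (PNode ts) = hooks (PNode (take i ts)) * (qint (Suc (num_edges (ts ! i))) * hooks (ts ! i))
    * hooks (PNode (drop (Suc i) ts))"
proof -
  have "hooks (PNode (take i ts @ ts ! i # drop (Suc i) ts)) = hooks (PNode (take i ts)) * (qint (Suc (num_edges (ts ! i))) * hooks (ts ! i))
    * hooks (PNode (drop (Suc i) ts))"
    by (simp add: mult.assoc)
  then show ?thesis
    using assms by (simp only: id_take_nth_drop[symmetric])
qed

lemma hook_ratio_Nil:
  assumes "i < length ts" "ts ! i = PNode []"
  shows "hook_ratio (PNode ts) [i] = 1"
proof -
  have "hooks (PNode ts) = hooks (delete_leaf (PNode ts) [i])"
    using assms hooks_split[OF assms(1)] by simp
  then show ?thesis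
    by (simp add: hook_ratio_def del: hooks.simps delete_leaf.simps)
qed

lemma hook_ratio_Cons:
  assumes "i < length ts" "v \<in> leaves (ts ! i)"
  shows "hook_ratio (PNode ts) (i # v) * to_fract (qint (num_edges (ts ! i))) =
    to_fract (qint (Suc (num_edges (ts ! i)))) * hook_ratio (ts ! i) v"
proof -
  define t where "t = delete_leaf (ts ! i) v"
  have e: "Suc (num_edges t) = num_edges (ts ! i)"
    using num_edges_delete_leaf[OF assms(2)] by (simp add: t_def)
  have "v \<noteq> []"
    using assms by (auto simp: leaves_def)
  then have d: "delete_leaf (PNode ts) (i # v) = PNode (ts[i := t])"
    by (simp add: delete_leaf_Cons t_def)
  define A where "A = hooks (PNode (take i ts)) * hooks (PNode (drop (Suc i) ts))"
  have A: "A \<noteq> 0" by (simp add: A_def del: hooks.simps)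
  have "hooks (PNode ts) = A * (qint (Suc (num_edges (ts ! i))) * hooks (ts ! i))"
    unfolding hooks_split[OF assms(1)] A_def by (simp add: ac_simps)
  moreover have "hooks (PNode (ts[i := t])) = A * (qint (num_edges (ts ! i)) * hooks t)"
    using assms(1) hooks_split[of i "ts[i := t]"] by (simp add: A_def e ac_simps)
  moreover have "qint (num_edges (ts ! i)) \<noteq> 0"
    unfolding e[symmetric] by simp
  ultimately show ?thesis
    using A unfolding hook_ratio_def d t_def[symmetric] by (simp add: field_simps)
qed

lemma sum_hook_ratio:
  "(\<Sum>v\<in>leaves t. to_fract (monom 1 (right_edges t v)) * hook_ratio t v) = to_fract (qint (num_edges t))"
proof (induction t)
  case (PNode ts)
  define R where "R i = (\<Sum>t\<leftarrow>drop (Suc i) ts. Suc (num_edges t))" for i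
  define w where "w v = to_fract (monom 1 (right_edges (PNode ts) v)) * hook_ratio (PNode ts) v" for v
  have inner: "(\<Sum>v\<in>(#) i ` tips (ts ! i). w v) =
      to_fract (monom 1 (R i) * qint (Suc (num_edges (ts ! i))))" if i: "i < length ts" for i
  proof (cases "ts ! i = PNode []")
    case True
    then show ?thesis
      using hook_ratio_Nil[OF i True] by (simp add: w_def tips_def R_def)
  next
    case False
    define e where "e = num_edges (ts ! i)"
    have "e \<noteq> 0"
      using False by (simp add: e_def num_edges_eq_0_iff)
    then obtain e' where "e = Suc e'"
      using not0_implies_Suc by blast
    then have nz: "to_fract (qint e) \<noteq> 0"
      by simp
    have IH: "(\<Sum>v\<in>leaves (ts ! i). to_fract (monom 1 (right_edges (ts ! i) v)) * hook_ratio (ts ! i) v) = to_fract (qint e)"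
      unfolding e_def by (rule PNode) (use i in simp)
    have "(\<Sum>v\<in>(#) i ` tips (ts ! i). w v) * to_fract (qint e) = (\<Sum>v\<in>leaves (ts ! i). w (i # v) * to_fract (qint e))"
      using False by (subst sum.reindex) (auto simp: tips_def sum_distrib_right)
    also have "\<dots> = (\<Sum>v\<in>leaves (ts ! i). to_fract (monom 1 (R i) * qint (Suc e)) *
        (to_fract (monom 1 (right_edges (ts ! i) v)) * hook_ratio (ts ! i) v))"
    proof (rule sum.cong)
      fix v assume v: "v \<in> leaves (ts ! i)"
      have "monom 1 (right_edges (PNode ts) (i # v)) = monom (1::int) (right_edges (ts ! i) v) * monom 1 (R i)"
        by (simp add: R_def mult_monom)
      then show "w (i # v) * to_fract (qint e) = to_fract (monom 1 (R i) * qint (Suc e)) *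
          (to_fract (monom 1 (right_edges (ts ! i) v)) * hook_ratio (ts ! i) v)"
        using arg_cong[OF hook_ratio_Cons[OF i v],
            of "\<lambda>x. to_fract (monom 1 (R i)) * to_fract (monom 1 (right_edges (ts ! i) v)) * x"]
        unfolding w_def e_def by (simp only: to_fract_mult) (simp only: ac_simps)
    qed simp
    also have "\<dots> = to_fract (monom 1 (R i) * qint (Suc e)) * to_fract (qint e)"
      by (simp only: sum_distrib_left[symmetric] IH)
    finally show ?thesis
      using nz by (simp add: e_def)
  qed
  have "(\<Sum>v\<in>leaves (PNode ts). w v) = (\<Sum>i<length ts. \<Sum>v\<in>(#) i ` tips (ts ! i). w v)"
    unfolding leaves_PNode by (rule sum.UNION_disjoint) (auto simp: finite_tips)
  also have "\<dots> = (\<Sum>i<length ts. to_fract (monom 1 (R i) * qint (Suc (num_edges (ts ! i)))))"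
    by (rule sum.cong) (use inner in auto)
  also have "\<dots> = to_fract (qint (num_edges (PNode ts)))"
    unfolding to_fract_sum[symmetric] R_def qint_rest_sum ..
  finally show ?case by (simp add: w_def)
qed

lemma plucking_hooks: "plucking t * hooks t = qfact (num_edges t)"
proof (induction t rule: plucking.induct)
  case (1 t)
  show ?case
  proof (cases "t = PNode []")
    case True
    then show ?thesis by (simp add: plucking.simps)
  next
    case False
    then have "num_edges t \<noteq> 0"
      by (simp add: num_edges_eq_0_iff)
    then obtain n where n: "num_edges t = Suc n"
      using not0_implies_Suc by blast
    have "to_fract (plucking t * hooks t) =
        (\<Sum>v\<in>leaves t. to_fract (monom 1 (right_edges t v)) * to_fract (plucking (delete_leaf t v)) * to_fract (hooks t))"
      using False by (subst plucking.simps) (simp add: to_fract_sum sum_distrib_right)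
    also have "\<dots> = (\<Sum>v\<in>leaves t. to_fract (qfact n) * (to_fract (monom 1 (right_edges t v)) * hook_ratio t v))"
    proof (rule sum.cong)
      fix v assume v: "v \<in> leaves t"
      have "num_edges (delete_leaf t v) = n"
        using num_edges_delete_leaf[OF v] n by simp
      then have "to_fract (qfact n) = to_fract (plucking (delete_leaf t v)) * to_fract (hooks (delete_leaf t v))"
        using "1.IH"[OF False v] by (metis to_fract_mult)
      then show "to_fract (monom 1 (right_edges t v)) * to_fract (plucking (delete_leaf t v)) * to_fract (hooks t) =
          to_fract (qfact n) * (to_fract (monom 1 (right_edges t v)) * hook_ratio t v)"
        by (simp add: hook_ratio_def)
    qed simp
    also have "\<dots> = to_fract (qfact (num_edges t))"
      by (simp only: sum_distrib_left[symmetric] sum_hook_ratio) (simp add: n mult.commute)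
    finally show ?thesis by (simp only: to_fract_eq_iff)
  qed
qed

lemma plucking_Cons:
  "plucking (PNode (t # ts)) =
     gauss (Suc (num_edges t)) (num_edges (PNode ts)) * (plucking t * plucking (PNode ts))"
proof -
  define a b where "a = num_edges t" and "b = num_edges (PNode ts)"
  have "gauss (Suc a) b * (plucking t * plucking (PNode ts)) * hooks (PNode (t # ts)) =
      gauss (Suc a) b * (qint (Suc a) * (plucking t * hooks t)) * (plucking (PNode ts) * hooks (PNode ts))"
    by (simp add: a_def ac_simps)
  also have "\<dots> = qfact (Suc a + b)"
    unfolding plucking_hooks gauss_qfact[symmetric] by (simp add: a_def b_def)
  also have "\<dots> = plucking (PNode (t # ts)) * hooks (PNode (t # ts))"
    unfolding plucking_hooks by (simp add: a_def b_def)
  finally show ?thesis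
    by (simp add: a_def b_def del: hooks.simps)
qed

section \<open>Derivations of polynomial rings\<close>

lemma (in Vector_Spaces.linear) card_spanning_image:
  assumes B: "vs1.independent B" "finite B" and C: "vs2.independent C"
    and surj: "f ` vs1.span B = vs2.span C"
  shows "card C \<le> card B"
    and "card C < card B \<longleftrightarrow> (\<exists>w\<in>vs1.span B. w \<noteq> 0 \<and> f w = 0)"
proof -
  have span: "vs2.span (f ` A) = f ` vs1.span A" for A
    by (rule span_image)
  have le: "card C \<le> card A" if "finite A" "f ` vs1.span A = vs2.span C" for A
  proof -
    have "card C = vs2.dim (vs2.span C)"
      using C by (rule vs2.dim_span_eq_card_independent[symmetric])
    also have "\<dots> \<le> card (f ` A)"
      using that span[of A] by (intro vs2.dim_le_card) auto
    also have "\<dots> \<le> card A"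
      using that by (intro card_image_le)
    finally show ?thesis .
  qed
  show "card C \<le> card B"
    using B surj by (intro le)
  show "card C < card B \<longleftrightarrow> (\<exists>w\<in>vs1.span B. w \<noteq> 0 \<and> f w = 0)"
  proof
    assume less: "card C < card B"
    show "\<exists>w\<in>vs1.span B. w \<noteq> 0 \<and> f w = 0"
    proof (rule ccontr)
      assume "\<not> ?thesis"
      then have inj: "inj_on f (vs1.span B)"
        by (subst inj_on_iff_eq_0) (auto simp: vs1.subspace_span)
      then have "vs2.independent (f ` B)"
        using B by (intro independent_injective_image)
      moreover have "card (f ` B) = card B"
        using inj vs1.span_superset by (intro card_image) (rule inj_on_subset)
      moreover have "vs2.dim (vs2.span (f ` B)) = vs2.dim (vs2.span C)"
        using span[of B] surj by simp
      ultimately show False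
        using less vs2.dim_span_eq_card_independent[OF C] vs2.dim_span_eq_card_independent[of "f ` B"]
        by linarith
    qed
  next
    assume "\<exists>w\<in>vs1.span B. w \<noteq> 0 \<and> f w = 0"
    then obtain w where w: "w \<in> vs1.span B" "w \<noteq> 0" "f w = 0"
      by blast
    have "vs1.independent {w}" using w by simp
    then obtain A where A: "{w} \<subseteq> A" "A \<subseteq> vs1.span B" "vs1.independent A" "vs1.span B \<subseteq> vs1.span A"
      using vs1.maximal_independent_subset_extend[of "{w}" "vs1.span B"] w(1) by auto
    have eq: "vs1.span A = vs1.span B"
      using A vs1.span_minimal[OF A(2)] by (auto simp: vs1.subspace_span)
    have fin: "finite A"
      using vs1.independent_span_bound[OF B(2) A(3,2)] by simp
    have cards: "card A = card B"
      using eq A(3) B(1) by (metis vs1.dim_span_eq_card_independent)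
    have "A = insert w (A - {w})" using A(1) by auto
    then have "f ` vs1.span A = vs2.span (insert 0 (f ` (A - {w})))"
      using w(3) by (metis image_insert span)
    also have "\<dots> = f ` vs1.span (A - {w})"
      using span[of "A - {w}"] by (simp only: vs2.span_insert_0)
    finally have "card C \<le> card (A - {w})"
      using fin surj eq by (intro le) auto
    also have "\<dots> < card A"
      using A(1) fin by (intro psubset_card_mono) auto
    finally show "card C < card B"
      using cards by simp
  qed
qed

type_synonym mpoly = "(nat \<Rightarrow>\<^sub>0 nat) \<Rightarrow>\<^sub>0 real"

abbreviation const :: "real \<Rightarrow> mpoly" where "const c \<equiv> Poly_Mapping.single 0 c"
abbreviation mono_of :: "(nat \<Rightarrow>\<^sub>0 nat) \<Rightarrow> mpoly" where "mono_of \<alpha> \<equiv> Poly_Mapping.single \<alpha> 1"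
abbreviation unit_exp :: "nat \<Rightarrow> nat \<Rightarrow>\<^sub>0 nat" where "unit_exp j \<equiv> Poly_Mapping.single j (Suc 0)"
abbreviation var :: "nat \<Rightarrow> mpoly" where "var j \<equiv> mono_of (unit_exp j)"

lemma single_eq_const_mult: "Poly_Mapping.single \<alpha> c = const c * mono_of \<alpha>"
  by (simp add: mult_single)

lemma const_add: "const (c + d) = const c + const d"
  by (rule single_add)

lemma const_sum: "const (sum f A) = (\<Sum>x\<in>A. const (f x))"
  by (induction A rule: infinite_finite_induct) (auto simp: const_add)

lemma const_mult: "const (c * d) = const c * const d"
  by (simp add: mult_single)

lemma mono_of_add: "mono_of (\<alpha> + \<beta>) = mono_of \<alpha> * mono_of \<beta>"
  by (simp add: mult_single)

lemma const_of_nat: "const (of_nat n) = of_nat n"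
  by (metis single_of_nat)

lemma lookup_const_mult: "Poly_Mapping.lookup (const c * p) \<alpha> = c * Poly_Mapping.lookup p \<alpha>"
  by (simp add: mult_map_scale_conv_mult[symmetric] map.rep_eq when_def)

lemma mpoly_expand: "p = (\<Sum>\<alpha>\<in>Poly_Mapping.keys p. Poly_Mapping.single \<alpha> (Poly_Mapping.lookup p \<alpha>))"
  by (rule poly_mapping_eqI)
     (auto simp: lookup_sum lookup_single when_def in_keys_iff sum.delta' intro!: sum.neutral[symmetric])

lemma mpoly_induct [case_names monom add]:
  assumes "\<And>\<alpha> c. P (const c * mono_of \<alpha>)" "\<And>p q. P p \<Longrightarrow> P q \<Longrightarrow> P (p + q)"
  shows "P p"
proof -
  have P0: "P 0" using assms(1)[of 0 0] by simp
  have "P (\<Sum>\<alpha>\<in>A. Poly_Mapping.single \<alpha> (Poly_Mapping.lookup p \<alpha>))" if "finite A" for A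
    using that by induction (use P0 assms(2) assms(1)[folded single_eq_const_mult] in auto)
  from this[OF finite_keys[of p]] show ?thesis
    by (subst mpoly_expand[of p])
qed

lemma exponent_induct [case_names zero step]:
  fixes \<alpha> :: "nat \<Rightarrow>\<^sub>0 nat"
  assumes "P 0" "\<And>\<alpha> j. P \<alpha> \<Longrightarrow> P (\<alpha> + unit_exp j)"
  shows "P \<alpha>"
proof (induction "\<Sum>j\<in>Poly_Mapping.keys \<alpha>. Poly_Mapping.lookup \<alpha> j" arbitrary: \<alpha> rule: less_induct)
  case less
  show ?case
  proof (cases "\<alpha> = 0")
    case False
    then obtain j where j: "j \<in> Poly_Mapping.keys \<alpha>" by (meson all_not_in_conv keys_eq_empty)
    define \<beta> where "\<beta> = \<alpha> - unit_exp j"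
    have eq: "\<alpha> = \<beta> + unit_exp j"
      by (rule poly_mapping_eqI) (use j in \<open>auto simp: \<beta>_def lookup_add lookup_minus lookup_single when_def in_keys_iff\<close>)
    have "(\<Sum>j\<in>Poly_Mapping.keys \<alpha>. Poly_Mapping.lookup \<alpha> j) =
        (\<Sum>j\<in>Poly_Mapping.keys \<beta>. Poly_Mapping.lookup \<beta> j) + 1"
      unfolding eq by (subst setsum_keys_plus_distrib) auto
    then have "P \<beta>" by (intro less) simp
    then show ?thesis unfolding eq by (rule assms)
  qed (use assms in simp)
qed

definition derive_mono :: "(nat \<Rightarrow> mpoly) \<Rightarrow> (nat \<Rightarrow>\<^sub>0 nat) \<Rightarrow> mpoly" where
  "derive_mono u \<alpha> = (\<Sum>j\<in>Poly_Mapping.keys \<alpha>. of_nat (Poly_Mapping.lookup \<alpha> j) * mono_of (\<alpha> - unit_exp j) * u j)"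

definition derivation :: "(nat \<Rightarrow> mpoly) \<Rightarrow> mpoly \<Rightarrow> mpoly" where
  "derivation u p = (\<Sum>\<alpha>\<in>Poly_Mapping.keys p. const (Poly_Mapping.lookup p \<alpha>) * derive_mono u \<alpha>)"

lemma derive_mono_superset:
  assumes "finite J" "Poly_Mapping.keys \<alpha> \<subseteq> J"
  shows "derive_mono u \<alpha> = (\<Sum>j\<in>J. of_nat (Poly_Mapping.lookup \<alpha> j) * mono_of (\<alpha> - unit_exp j) * u j)"
  unfolding derive_mono_def
  by (rule sum.mono_neutral_left) (use assms in \<open>auto simp: in_keys_iff\<close>)

lemma derivation_superset:
  assumes "finite A" "Poly_Mapping.keys p \<subseteq> A"
  shows "derivation u p = (\<Sum>\<alpha>\<in>A. const (Poly_Mapping.lookup p \<alpha>) * derive_mono u \<alpha>)"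
  unfolding derivation_def
  by (rule sum.mono_neutral_left) (use assms in \<open>auto simp: in_keys_iff\<close>)

lemma derivation_add: "derivation u (p + q) = derivation u p + derivation u q"
proof -
  define A where "A = Poly_Mapping.keys p \<union> Poly_Mapping.keys q"
  have A: "finite A" "Poly_Mapping.keys p \<subseteq> A" "Poly_Mapping.keys q \<subseteq> A" "Poly_Mapping.keys (p + q) \<subseteq> A"
    using keys_add[of p q] by (auto simp: A_def)
  show ?thesis
    unfolding A(2-4)[THEN derivation_superset[OF A(1)]]
    by (simp add: lookup_add const_add distrib_right sum.distrib)
qed

lemma derivation_const_mult: "derivation u (const c * p) = const c * derivation u p"
proof -
  have "Poly_Mapping.keys (const c * p) \<subseteq> Poly_Mapping.keys p"
    by (auto simp: in_keys_iff lookup_const_mult)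
  then have "derivation u (const c * p) =
      (\<Sum>\<alpha>\<in>Poly_Mapping.keys p. const (Poly_Mapping.lookup (const c * p) \<alpha>) * derive_mono u \<alpha>)"
    by (intro derivation_superset) auto
  also have "\<dots> = const c * derivation u p"
    unfolding derivation_def sum_distrib_left
    by (intro sum.cong refl) (simp only: lookup_const_mult const_mult mult.assoc)
  finally show ?thesis .
qed

lemma derivation_0 [simp]: "derivation u 0 = 0"
  by (simp add: derivation_def)

lemma derivation_1 [simp]: "derivation u 1 = 0"
  by (simp add: derivation_def derive_mono_def)

lemma derivation_diff: "derivation u (p - q) = derivation u p - derivation u q"
  using derivation_add[of u "p - q" q] by (simp add: algebra_simps)

lemma derivation_mono_of: "derivation u (mono_of \<alpha>) = derive_mono u \<alpha>"
  by (simp add: derivation_def)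

lemma derivation_var [simp]: "derivation u (var j) = u j"
  by (simp add: derivation_mono_of derive_mono_def)

lemma derive_mono_add:
  "derive_mono u (\<alpha> + \<beta>) = derive_mono u \<alpha> * mono_of \<beta> + mono_of \<alpha> * derive_mono u \<beta>"
proof -
  define J where "J = Poly_Mapping.keys \<alpha> \<union> Poly_Mapping.keys \<beta>"
  have J: "finite J" "Poly_Mapping.keys \<alpha> \<subseteq> J" "Poly_Mapping.keys \<beta> \<subseteq> J" "Poly_Mapping.keys (\<alpha> + \<beta>) \<subseteq> J"
    using keys_add[of \<alpha> \<beta>] by (auto simp: J_def)
  have *: "of_nat (Poly_Mapping.lookup \<alpha> j) * mono_of (\<alpha> + \<beta> - unit_exp j) =
      of_nat (Poly_Mapping.lookup \<alpha> j) * (mono_of (\<alpha> - unit_exp j) * mono_of \<beta>)" for \<alpha> \<beta> j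
  proof (cases "Poly_Mapping.lookup \<alpha> j = 0")
    case False
    have "\<alpha> + \<beta> - unit_exp j = \<alpha> - unit_exp j + \<beta>"
      by (rule poly_mapping_eqI) (use False in \<open>auto simp: lookup_add lookup_minus lookup_single when_def\<close>)
    then show ?thesis by (simp add: mono_of_add)
  qed simp
  show ?thesis
    unfolding J(2-4)[THEN derive_mono_superset[OF J(1)]] sum_distrib_left sum_distrib_right sum.distrib[symmetric]
  proof (intro sum.cong refl)
    fix j
    have "of_nat (Poly_Mapping.lookup (\<alpha> + \<beta>) j) * mono_of (\<alpha> + \<beta> - unit_exp j) =
        of_nat (Poly_Mapping.lookup \<alpha> j) * (mono_of (\<alpha> - unit_exp j) * mono_of \<beta>) +
        of_nat (Poly_Mapping.lookup \<beta> j) * (mono_of (\<beta> - unit_exp j) * mono_of \<alpha>)"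
      using *[of \<alpha> j \<beta>] *[of \<beta> j \<alpha>] by (simp only: lookup_add of_nat_add distrib_right add.commute)
    then show "of_nat (Poly_Mapping.lookup (\<alpha> + \<beta>) j) * mono_of (\<alpha> + \<beta> - unit_exp j) * u j =
        of_nat (Poly_Mapping.lookup \<alpha> j) * mono_of (\<alpha> - unit_exp j) * u j * mono_of \<beta> +
        mono_of \<alpha> * (of_nat (Poly_Mapping.lookup \<beta> j) * mono_of (\<beta> - unit_exp j) * u j)"
      by (simp only: distrib_left distrib_right ac_simps)
  qed
qed

lemma derivation_mult: "derivation u (p * q) = derivation u p * q + p * derivation u q"
proof (induction p rule: mpoly_induct)
  case (monom \<alpha> c)
  show ?case
  proof (induction q rule: mpoly_induct)
    case (monom \<beta> d)
    have "const c * mono_of \<alpha> * (const d * mono_of \<beta>) = const c * (const d * mono_of (\<alpha> + \<beta>))"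
      by (simp only: mono_of_add ac_simps)
    then show ?case
      by (simp only: derivation_const_mult derivation_mono_of derive_mono_add) (simp add: algebra_simps)
  qed (simp add: derivation_add distrib_left algebra_simps)
qed (simp add: derivation_add distrib_left algebra_simps)

lemma derivation_commutator:
  "derivation u (derivation v p) - derivation v (derivation u p) =
     derivation (\<lambda>j. derivation u (v j) - derivation v (u j)) p"
proof (induction p rule: mpoly_induct)
  case (monom \<alpha> c)
  have "derivation u (derivation v (mono_of \<alpha>)) - derivation v (derivation u (mono_of \<alpha>)) =
     derivation (\<lambda>j. derivation u (v j) - derivation v (u j)) (mono_of \<alpha>)"
  proof (induction \<alpha> rule: exponent_induct)
    case zero
    show ?case by simp
  next
    case (step \<alpha> j)
    show ?case
      unfolding mono_of_add derivation_mult derivation_add derivation_var step[symmetric]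
      by (simp add: algebra_simps)
  qed
  then show ?case
    by (simp only: derivation_const_mult right_diff_distrib[symmetric])
next
  case (add p q)
  then show ?case by (simp add: derivation_add algebra_simps)
qed

lemma derivation_scaled_vars:
  assumes "\<And>j. u j = const (c j) * var j"
  shows "derivation u (mono_of \<alpha>) = const (\<Sum>j\<in>Poly_Mapping.keys \<alpha>. of_nat (Poly_Mapping.lookup \<alpha> j) * c j) * mono_of \<alpha>"
proof -
  have "derivation u (mono_of \<alpha>) =
      (\<Sum>j\<in>Poly_Mapping.keys \<alpha>. const (of_nat (Poly_Mapping.lookup \<alpha> j) * c j) * mono_of \<alpha>)"
    unfolding derivation_mono_of derive_mono_def
  proof (rule sum.cong)
    fix j assume "j \<in> Poly_Mapping.keys \<alpha>"
    then have "\<alpha> = (\<alpha> - unit_exp j) + unit_exp j"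
      by (intro poly_mapping_eqI) (auto simp: lookup_add lookup_minus lookup_single when_def in_keys_iff)
    then have "mono_of \<alpha> = mono_of (\<alpha> - unit_exp j) * var j"
      by (metis mono_of_add)
    then show "of_nat (Poly_Mapping.lookup \<alpha> j) * mono_of (\<alpha> - unit_exp j) * u j =
        const (of_nat (Poly_Mapping.lookup \<alpha> j) * c j) * mono_of \<alpha>"
      by (simp only: assms const_mult const_of_nat ac_simps)
  qed simp
  also have "\<dots> = const (\<Sum>j\<in>Poly_Mapping.keys \<alpha>. of_nat (Poly_Mapping.lookup \<alpha> j) * c j) * mono_of \<alpha>"
    unfolding sum_distrib_right[symmetric] const_sum ..
  finally show ?thesis .
qed

section \<open>Unimodality of Gaussian polynomials\<close>

primrec lower_var :: "nat \<Rightarrow> mpoly" where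
  "lower_var 0 = 0"
| "lower_var (Suc j) = var j"

definition raise_var :: "nat \<Rightarrow> nat \<Rightarrow> mpoly" where
  "raise_var b j = const ((real j + 1) * (real b - real j)) * var (Suc j)"

definition weight_var :: "nat \<Rightarrow> nat \<Rightarrow> mpoly" where
  "weight_var b j = const (real b - 2 * real j) * var j"

abbreviation "lower \<equiv> derivation lower_var"
abbreviation "raise b \<equiv> derivation (raise_var b)"
abbreviation "weight b \<equiv> derivation (weight_var b)"

lemma const_diff_mult: "const c * p - const d * p = const (c - d) * p"
  by (simp add: single_diff left_diff_distrib)

lemma const_add_mult: "const c * p + const d * p = const (c + d) * p"
  by (simp add: const_add distrib_right)

lemma derivation_scale: "derivation (\<lambda>j. const c * u j) p = const c * derivation u p"
  unfolding derivation_def derive_mono_def sum_distrib_left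
  by (intro sum.cong refl) (simp only: ac_simps)

lemma lower_raise: "lower (raise b p) = raise b (lower p) + weight b p"
proof -
  have "lower (raise_var b j) - raise b (lower_var j) = weight_var b j" for j
  proof (cases j)
    case 0
    then show ?thesis
      by (simp add: raise_var_def weight_var_def derivation_const_mult del: single_of_nat)
  next
    case (Suc i)
    have eq: "(real (Suc i) + 1) * (real b - real (Suc i)) - (real i + 1) * (real b - real i) =
        real b - 2 * real (Suc i)"
      by (simp add: algebra_simps)
    show ?thesis
      unfolding Suc raise_var_def weight_var_def derivation_const_mult lower_var.simps derivation_var
        const_diff_mult eq ..
  qed
  then show ?thesis
    using derivation_commutator[of lower_var "raise_var b" p] by (simp add: algebra_simps)
qed

lemma weight_lower: "weight b (lower p) = lower (weight b p) + const 2 * lower p"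
proof -
  have "weight b (lower_var j) - lower (weight_var b j) = const 2 * lower_var j" for j
  proof (cases j)
    case 0
    then show ?thesis
      by (simp add: weight_var_def derivation_const_mult del: single_of_nat)
  next
    case (Suc i)
    have eq: "real b - 2 * real i - (real b - 2 * real (Suc i)) = 2"
      by simp
    show ?thesis
      unfolding Suc weight_var_def derivation_const_mult lower_var.simps derivation_var
        const_diff_mult eq ..
  qed
  then have "weight b (lower p) - lower (weight b p) = const 2 * lower p"
    by (simp only: derivation_commutator derivation_scale)
  then show ?thesis
    by (simp add: algebra_simps)
qed

lemma weight_lower_pow:
  assumes "weight b p = const h * p"
  shows "weight b ((lower ^^ k) p) = const (h + 2 * real k) * (lower ^^ k) p"
proof (induction k)
  case (Suc k)
  have "weight b ((lower ^^ Suc k) p) = const (h + 2 * real k) * (lower ^^ Suc k) p + const 2 * (lower ^^ Suc k) p"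
    by (simp only: funpow.simps comp_apply weight_lower Suc derivation_const_mult)
  then show ?case
    by (simp only: const_add_mult) (simp add: algebra_simps)
qed (use assms in simp)

lemma lower_pow_raise:
  assumes "weight b p = const h * p"
  shows "(lower ^^ Suc k) (raise b p) =
    raise b ((lower ^^ Suc k) p) + const ((real k + 1) * (h + real k)) * (lower ^^ k) p"
proof (induction k)
  case 0
  show ?case using assms by (simp add: lower_raise)
next
  case (Suc k)
  have eq: "h + 2 * real (Suc k) + (real k + 1) * (h + real k) = (real (Suc k) + 1) * (h + real (Suc k))"
    by (simp add: algebra_simps)
  have "(lower ^^ Suc (Suc k)) (raise b p) = lower ((lower ^^ Suc k) (raise b p))"
    by simp
  also have "\<dots> = lower (raise b ((lower ^^ Suc k) p)) +
      const ((real k + 1) * (h + real k)) * (lower ^^ Suc k) p"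
    unfolding Suc derivation_add derivation_const_mult by simp
  also have "\<dots> = raise b ((lower ^^ Suc (Suc k)) p) + (const (h + 2 * real (Suc k)) * (lower ^^ Suc k) p +
      const ((real k + 1) * (h + real k)) * (lower ^^ Suc k) p)"
    using weight_lower_pow[OF assms, of "Suc k"] by (simp only: lower_raise funpow.simps comp_apply add.assoc)
  finally show ?case
    by (simp only: const_add_mult eq)
qed

definition deg_upto :: "nat \<Rightarrow> (nat \<Rightarrow>\<^sub>0 nat) \<Rightarrow> nat" where
  "deg_upto b \<alpha> = (\<Sum>j\<le>b. Poly_Mapping.lookup \<alpha> j)"

definition wt_upto :: "nat \<Rightarrow> (nat \<Rightarrow>\<^sub>0 nat) \<Rightarrow> nat" where
  "wt_upto b \<alpha> = (\<Sum>j\<le>b. j * Poly_Mapping.lookup \<alpha> j)"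

definition expo :: "nat \<Rightarrow> nat \<Rightarrow> nat \<Rightarrow> (nat \<Rightarrow>\<^sub>0 nat) set" where
  "expo a b i = {\<alpha>. Poly_Mapping.keys \<alpha> \<subseteq> {..b} \<and> deg_upto b \<alpha> = a \<and> wt_upto b \<alpha> = i}"

definition hom :: "nat \<Rightarrow> nat \<Rightarrow> nat \<Rightarrow> mpoly set" where
  "hom a b i = {p. Poly_Mapping.keys p \<subseteq> expo a b i}"

lemma deg_upto_add: "deg_upto b (\<alpha> + \<beta>) = deg_upto b \<alpha> + deg_upto b \<beta>"
  by (simp add: deg_upto_def lookup_add sum.distrib)

lemma wt_upto_add: "wt_upto b (\<alpha> + \<beta>) = wt_upto b \<alpha> + wt_upto b \<beta>"
  by (simp add: wt_upto_def lookup_add sum.distrib distrib_left)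

lemma keys_add_nat: "Poly_Mapping.keys (\<alpha> + \<beta>) = Poly_Mapping.keys \<alpha> \<union> Poly_Mapping.keys (\<beta> :: nat \<Rightarrow>\<^sub>0 nat)"
  by (auto simp: in_keys_iff lookup_add)

lemma expo_add:
  "\<alpha> \<in> expo a b i \<Longrightarrow> \<beta> \<in> expo a' b i' \<Longrightarrow> \<alpha> + \<beta> \<in> expo (a + a') b (i + i')"
  by (simp add: expo_def deg_upto_add wt_upto_add keys_add_nat)

lemma upto_unit_exp:
  "j \<le> b \<Longrightarrow> deg_upto b (unit_exp j) = 1"
  "j \<le> b \<Longrightarrow> wt_upto b (unit_exp j) = j"
  by (simp_all add: deg_upto_def wt_upto_def lookup_single when_def if_distrib cong: if_cong)

lemma expo_move:
  assumes "\<alpha> \<in> expo a b i" "j \<in> Poly_Mapping.keys \<alpha>" "l \<le> b"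
  shows "\<alpha> - unit_exp j + unit_exp l \<in> expo a b (i + l - j)"
proof -
  define \<beta> where "\<beta> = \<alpha> - unit_exp j"
  have eq: "\<alpha> = \<beta> + unit_exp j"
    by (rule poly_mapping_eqI) (use assms in \<open>auto simp: \<beta>_def lookup_add lookup_minus lookup_single when_def in_keys_iff\<close>)
  have "j \<le> b" using assms by (auto simp: expo_def)
  then show ?thesis
    using assms(1,3) unfolding \<beta>_def[symmetric]
    by (auto simp: eq expo_def keys_add_nat deg_upto_add wt_upto_add upto_unit_exp)
qed

lemma hom_0 [simp]: "0 \<in> hom a b i"
  by (simp add: hom_def)

lemma hom_add: "p \<in> hom a b i \<Longrightarrow> q \<in> hom a b i \<Longrightarrow> p + q \<in> hom a b i"
  using keys_add[of p q] by (auto simp: hom_def)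

lemma hom_const_mult: "p \<in> hom a b i \<Longrightarrow> const c * p \<in> hom a b i"
  by (auto simp: hom_def in_keys_iff lookup_const_mult subset_eq)

lemma hom_diff: "p \<in> hom a b i \<Longrightarrow> q \<in> hom a b i \<Longrightarrow> p - q \<in> hom a b i"
  using keys_diff[of p q] by (auto simp: hom_def)

lemma hom_sum: "(\<And>x. x \<in> A \<Longrightarrow> f x \<in> hom a b i) \<Longrightarrow> sum f A \<in> hom a b i"
  by (induction A rule: infinite_finite_induct) (auto intro: hom_add)

lemma hom_mono_of: "mono_of \<alpha> \<in> hom a b i \<longleftrightarrow> \<alpha> \<in> expo a b i"
  by (simp add: hom_def)

lemma hom_mult: "p \<in> hom a b i \<Longrightarrow> q \<in> hom a' b i' \<Longrightarrow> p * q \<in> hom (a + a') b (i + i')"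
  using keys_mult[of p q] by (fastforce simp: hom_def intro: expo_add)

lemma hom_derivation:
  assumes "p \<in> hom a b i"
    and "\<And>\<alpha> j. \<alpha> \<in> expo a b i \<Longrightarrow> j \<in> Poly_Mapping.keys \<alpha> \<Longrightarrow> mono_of (\<alpha> - unit_exp j) * u j \<in> hom a' b' i'"
  shows "derivation u p \<in> hom a' b' i'"
  unfolding derivation_def derive_mono_def
proof (intro hom_sum hom_const_mult)
  fix \<alpha> j assume "\<alpha> \<in> Poly_Mapping.keys p" "j \<in> Poly_Mapping.keys \<alpha>"
  then have "const (of_nat (Poly_Mapping.lookup \<alpha> j)) * (mono_of (\<alpha> - unit_exp j) * u j) \<in> hom a' b' i'"
    using assms by (intro hom_const_mult) (auto simp: hom_def)
  then show "of_nat (Poly_Mapping.lookup \<alpha> j) * mono_of (\<alpha> - unit_exp j) * u j \<in> hom a' b' i'"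
    by (simp only: const_of_nat mult.assoc)
qed

lemma hom_lower:
  assumes "p \<in> hom a b (Suc i)"
  shows "lower p \<in> hom a b i"
  using assms
proof (rule hom_derivation)
  fix \<alpha> j assume *: "\<alpha> \<in> expo a b (Suc i)" "j \<in> Poly_Mapping.keys \<alpha>"
  show "mono_of (\<alpha> - unit_exp j) * lower_var j \<in> hom a b i"
  proof (cases j)
    case (Suc l)
    have "l \<le> b" using * Suc by (auto simp: expo_def)
    then show ?thesis
      using expo_move[OF *, of l] by (simp add: Suc mono_of_add[symmetric] hom_mono_of)
  qed simp
qed

lemma lower_hom_0:
  assumes "p \<in> hom a b 0"
  shows "lower p = 0"
proof -
  have "lower_var j = 0" if "\<alpha> \<in> Poly_Mapping.keys p" "j \<in> Poly_Mapping.keys \<alpha>" for \<alpha> j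
  proof -
    have "\<alpha> \<in> expo a b 0" using assms that by (auto simp: hom_def)
    then have "j \<le> b" "j * Poly_Mapping.lookup \<alpha> j = 0"
      using that by (auto simp: expo_def wt_upto_def)
    then have "j = 0"
      using that by (auto simp: in_keys_iff)
    then show ?thesis by simp
  qed
  then show ?thesis
    by (simp add: derivation_def derive_mono_def)
qed

lemma hom_raise:
  assumes "p \<in> hom a b i"
  shows "raise b p \<in> hom a b (Suc i)"
  using assms
proof (rule hom_derivation)
  fix \<alpha> j assume *: "\<alpha> \<in> expo a b i" "j \<in> Poly_Mapping.keys \<alpha>"
  have "j \<le> b" using * by (auto simp: expo_def)
  show "mono_of (\<alpha> - unit_exp j) * raise_var b j \<in> hom a b (Suc i)"
  proof (cases "j = b")
    case True
    then show ?thesis by (simp add: raise_var_def)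
  next
    case False
    then have "mono_of (\<alpha> - unit_exp j + unit_exp (Suc j)) \<in> hom a b (Suc i)"
      using expo_move[OF *, of "Suc j"] \<open>j \<le> b\<close> by (simp add: hom_mono_of)
    then show ?thesis
      unfolding raise_var_def mult.left_commute[of "mono_of (\<alpha> - unit_exp j)"] mono_of_add
      by (rule hom_const_mult)
  qed
qed

lemma weight_hom:
  assumes "p \<in> hom a b i"
  shows "weight b p = const (real a * real b - 2 * real i) * p"
proof -
  have mono: "derive_mono (weight_var b) \<alpha> = const (real a * real b - 2 * real i) * mono_of \<alpha>"
    if "\<alpha> \<in> Poly_Mapping.keys p" for \<alpha>
  proof -
    have \<alpha>: "Poly_Mapping.keys \<alpha> \<subseteq> {..b}" "deg_upto b \<alpha> = a" "wt_upto b \<alpha> = i"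
      using that assms by (auto simp: hom_def expo_def)
    have "(\<Sum>j\<in>Poly_Mapping.keys \<alpha>. of_nat (Poly_Mapping.lookup \<alpha> j) * (real b - 2 * real j)) =
        (\<Sum>j\<le>b. of_nat (Poly_Mapping.lookup \<alpha> j) * (real b - 2 * real j))"
      by (rule sum.mono_neutral_left) (use \<alpha> in \<open>auto simp: in_keys_iff\<close>)
    also have "\<dots> = real (deg_upto b \<alpha>) * real b - 2 * real (wt_upto b \<alpha>)"
      by (simp add: deg_upto_def wt_upto_def sum_subtractf sum_distrib_left sum_distrib_right algebra_simps)
    finally show ?thesis
      using derivation_scaled_vars[of "weight_var b" "\<lambda>j. real b - 2 * real j" \<alpha>] \<alpha>
      unfolding weight_var_def derivation_mono_of by simp
  qed
  have "weight b p = (\<Sum>\<alpha>\<in>Poly_Mapping.keys p. const (Poly_Mapping.lookup p \<alpha>) *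
      (const (real a * real b - 2 * real i) * mono_of \<alpha>))"
    unfolding derivation_def by (intro sum.cong refl arg_cong2[where f = "(*)"] mono)
  also have "\<dots> = const (real a * real b - 2 * real i) *
      (\<Sum>\<alpha>\<in>Poly_Mapping.keys p. Poly_Mapping.single \<alpha> (Poly_Mapping.lookup p \<alpha>))"
    unfolding sum_distrib_left by (intro sum.cong refl) (simp add: mult_single mult.commute)
  finally show ?thesis
    by (simp only: mpoly_expand[symmetric])
qed

text \<open>
  Since \<open>(lower ^^ Suc k) (raise b p)\<close> is a positive multiple of \<open>(lower ^^ k) p\<close>, subtracting a multiple
  of \<open>lower (raise b p)\<close> from \<open>p\<close> makes it vanish under one power of \<open>lower\<close> less.
\<close>

lemma lower_surj_aux:
  assumes "2 * i < a * b"
  shows "p \<in> hom a b i \<Longrightarrow> (lower ^^ k) p = 0 \<Longrightarrow> \<exists>q\<in>hom a b (Suc i). lower q = p"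
proof (induction k arbitrary: p)
  case 0
  then show ?case by (intro bexI[of _ 0]) auto
next
  case (Suc k)
  define h where "h = real a * real b - 2 * real i"
  have "real (2 * i) < real (a * b)"
    using assms by (simp only: of_nat_less_iff)
  then have "0 < h" by (simp add: h_def)
  define c where "c = (real k + 1) * (h + real k)"
  have "c \<noteq> 0" using \<open>0 < h\<close> by (simp add: c_def)
  define r where "r = p - const (1 / c) * lower (raise b p)"
  have hom: "const (1 / c) * raise b p \<in> hom a b (Suc i)"
    using Suc.prems by (intro hom_const_mult hom_raise)
  have r_hom: "r \<in> hom a b i"
    using Suc.prems by (auto simp: r_def intro!: hom_diff hom_const_mult hom_lower hom_raise)
  have pow: "(lower ^^ k) (p - const x * q) = (lower ^^ k) p - const x * (lower ^^ k) q" for p q x k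
    by (induction k) (simp_all add: derivation_diff derivation_const_mult)
  have "(lower ^^ Suc k) (raise b p) = const c * (lower ^^ k) p"
    using lower_pow_raise[OF weight_hom[OF Suc.prems(1)], of k] Suc.prems(2)
    unfolding h_def[symmetric] c_def by (simp del: funpow.simps)
  then have "(lower ^^ k) (lower (raise b p)) = const c * (lower ^^ k) p"
    by (simp add: funpow_swap1)
  then have "(lower ^^ k) r = (lower ^^ k) p - const (1 / c * c) * (lower ^^ k) p"
    unfolding r_def pow by (simp only: const_mult mult.assoc)
  then have "(lower ^^ k) r = 0"
    using \<open>c \<noteq> 0\<close> by simp
  then obtain q where q: "q \<in> hom a b (Suc i)" "lower q = r"
    using Suc.IH r_hom by blast
  have "lower (q + const (1 / c) * raise b p) = p"
    by (simp add: derivation_add derivation_const_mult q r_def)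
  then show ?case
    using hom_add[OF q(1) hom] by blast
qed

lemma lower_pow_hom: "p \<in> hom a b i \<Longrightarrow> (lower ^^ Suc i) p = 0"
proof (induction i arbitrary: p)
  case (Suc i)
  then have "(lower ^^ Suc i) (lower p) = 0"
    by (intro Suc.IH hom_lower)
  then show ?case by (simp add: funpow_swap1)
qed (simp add: lower_hom_0)

lemma lower_surj:
  assumes "2 * i < a * b"
  shows "lower ` hom a b (Suc i) = hom a b i"
  using lower_surj_aux[OF assms _ lower_pow_hom] hom_lower by (fastforce simp: image_iff)

lemma expo_0: "expo 0 b i = (if i = 0 then {0} else {})"
proof -
  have "Poly_Mapping.keys \<alpha> \<subseteq> {..b} \<and> deg_upto b \<alpha> = 0 \<longleftrightarrow> \<alpha> = 0" for \<alpha>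
    by (auto simp: deg_upto_def poly_mapping_eq_iff fun_eq_iff in_keys_iff)
  then have "expo 0 b i = {\<alpha>. \<alpha> = 0 \<and> wt_upto b \<alpha> = i}"
    unfolding expo_def conj_assoc[symmetric] by (simp only:)
  then show ?thesis
    by (auto simp: wt_upto_def)
qed

lemma expo_0_right: "expo a 0 i = (if i = 0 then {Poly_Mapping.single 0 a} else {})"
proof -
  have "\<alpha> = Poly_Mapping.single 0 (Poly_Mapping.lookup \<alpha> 0)" if "Poly_Mapping.keys \<alpha> \<subseteq> {0}" for \<alpha> :: "nat \<Rightarrow>\<^sub>0 nat"
    by (rule poly_mapping_eqI) (use that in \<open>auto simp: lookup_single when_def in_keys_iff\<close>)
  then show ?thesis
    by (auto simp: expo_def deg_upto_def wt_upto_def split: if_splits)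
qed

lemma expo_Suc_Suc:
  "expo (Suc a) (Suc b) i = expo (Suc a) b i \<union>
     (if Suc b \<le> i then (\<lambda>\<alpha>. \<alpha> + unit_exp (Suc b)) ` expo a (Suc b) (i - Suc b) else {})" (is "_ = ?R")
proof (intro equalityI subsetI)
  fix \<alpha> assume \<alpha>: "\<alpha> \<in> expo (Suc a) (Suc b) i"
  show "\<alpha> \<in> ?R"
  proof (cases "Suc b \<in> Poly_Mapping.keys \<alpha>")
    case True
    define \<beta> where "\<beta> = \<alpha> - unit_exp (Suc b)"
    have eq: "\<alpha> = \<beta> + unit_exp (Suc b)"
      by (rule poly_mapping_eqI) (use True in \<open>auto simp: \<beta>_def lookup_add lookup_minus lookup_single when_def in_keys_iff\<close>)
    have "\<beta> \<in> expo a (Suc b) (i - Suc b)" "Suc b \<le> i"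
      using \<alpha> unfolding eq by (auto simp: expo_def keys_add_nat deg_upto_add wt_upto_add upto_unit_exp)
    then show ?thesis using eq by auto
  next
    case False
    have "Poly_Mapping.keys \<alpha> \<subseteq> {..b}"
      using \<alpha> False by (auto simp: expo_def subset_eq le_Suc_eq)
    then show ?thesis
      using \<alpha> False by (auto simp: expo_def deg_upto_def wt_upto_def in_keys_iff)
  qed
next
  fix \<alpha> assume "\<alpha> \<in> ?R"
  then consider "\<alpha> \<in> expo (Suc a) b i" | \<beta> where "Suc b \<le> i" "\<beta> \<in> expo a (Suc b) (i - Suc b)" "\<alpha> = \<beta> + unit_exp (Suc b)"
    by (auto split: if_splits)
  then show "\<alpha> \<in> expo (Suc a) (Suc b) i"
  proof cases
    case 1
    then have "Suc b \<notin> Poly_Mapping.keys \<alpha>"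
      by (auto simp: expo_def)
    then have "Poly_Mapping.lookup \<alpha> (Suc b) = 0"
      by (simp add: in_keys_iff)
    then show ?thesis
      using 1 by (auto simp: expo_def deg_upto_def wt_upto_def)
  next
    case 2
    then show ?thesis
      by (auto simp: expo_def keys_add_nat deg_upto_add wt_upto_add upto_unit_exp)
  qed
qed

lemma finite_expo_card: "finite (expo a b i) \<and> int (card (expo a b i)) = coeff (gauss a b) i"
proof (induction a b arbitrary: i rule: gauss.induct)
  case (1 b)
  then show ?case by (simp add: expo_0)
next
  case (2 a)
  then show ?case by (simp add: expo_0_right)
next
  case (3 a b)
  have disj: "expo (Suc a) b i \<inter> (\<lambda>\<alpha>. \<alpha> + unit_exp (Suc b)) ` expo a (Suc b) (i - Suc b) = {}"
    by (auto simp: expo_def keys_add_nat)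
  have inj: "inj_on (\<lambda>\<alpha>. \<alpha> + unit_exp (Suc b)) A" for A
    by (auto intro: inj_onI)
  show ?case
    using 3 disj by (auto simp: expo_Suc_Suc card_Un_disjoint card_image[OF inj] coeff_monom_mult)
qed

abbreviation mscale :: "real \<Rightarrow> mpoly \<Rightarrow> mpoly" where "mscale c p \<equiv> const c * p"

interpretation mpoly: vector_space mscale
  by standard (simp_all add: distrib_left const_add distrib_right const_mult mult.assoc)

interpretation lower: Vector_Spaces.linear mscale mscale lower
  by standard (simp_all add: derivation_add derivation_const_mult)

lemma span_mono_of: "mpoly.span (mono_of ` expo a b i) = hom a b i"
proof (intro equalityI subsetI)
  show "p \<in> hom a b i" if "p \<in> mpoly.span (mono_of ` expo a b i)" for p
    using that by (induction rule: mpoly.span_induct_alt) (auto intro!: hom_add hom_const_mult simp: hom_mono_of)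
next
  fix p assume "p \<in> hom a b i"
  then have "(\<Sum>\<alpha>\<in>Poly_Mapping.keys p. mscale (Poly_Mapping.lookup p \<alpha>) (mono_of \<alpha>)) \<in> mpoly.span (mono_of ` expo a b i)"
    by (intro mpoly.span_sum mpoly.span_scale mpoly.span_base) (auto simp: hom_def)
  then show "p \<in> mpoly.span (mono_of ` expo a b i)"
    unfolding single_eq_const_mult[symmetric] mpoly_expand[symmetric] .
qed

lemma mono_of_eq_iff [simp]: "mono_of \<alpha> = mono_of \<beta> \<longleftrightarrow> \<alpha> = \<beta>"
  by (metis keys_single singleton_inject zero_neq_one)

lemma independent_mono_of: "mpoly.independent (mono_of ` A)"
proof -
  have "u v = 0" if S: "finite S" "S \<subseteq> mono_of ` A" "(\<Sum>v\<in>S. mscale (u v) v) = 0" and v: "v \<in> S" for S u v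
  proof -
    obtain \<alpha> where \<alpha>: "v = mono_of \<alpha>"
      using S(2) v by blast
    have other: "Poly_Mapping.lookup w \<alpha> = 0" if w: "w \<in> S" "w \<noteq> v" for w
    proof -
      obtain \<beta> where "w = mono_of \<beta>"
        using S(2) w by blast
      then show ?thesis
        using w(2) \<alpha> by (auto simp: lookup_single when_def)
    qed
    have "0 = Poly_Mapping.lookup (\<Sum>w\<in>S. mscale (u w) w) \<alpha>"
      using S(3) by simp
    also have "\<dots> = (\<Sum>w\<in>S. u w * Poly_Mapping.lookup w \<alpha>)"
      by (simp add: lookup_sum lookup_const_mult)
    also have "\<dots> = (\<Sum>w\<in>{v}. u w * Poly_Mapping.lookup w \<alpha>)"
      by (rule sum.mono_neutral_right) (use S v other in auto)
    finally show "u v = 0" by (simp add: \<alpha>)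
  qed
  then show ?thesis
    unfolding mpoly.independent_explicit_finite_subsets by blast
qed

lemma card_mono_of: "card (mono_of ` A) = card A"
  by (rule card_image) (auto intro: inj_onI)

lemma gauss_step:
  assumes "2 * i < a * b"
  shows "coeff (gauss a b) i \<le> coeff (gauss a b) (Suc i)"
    and "coeff (gauss a b) i < coeff (gauss a b) (Suc i) \<longleftrightarrow> (\<exists>p\<in>hom a b (Suc i). p \<noteq> 0 \<and> lower p = 0)"
proof -
  have card: "coeff (gauss a b) l = int (card (mono_of ` expo a b l))" for l
    using finite_expo_card by (simp add: card_mono_of)
  have fin: "finite (mono_of ` expo a b (Suc i))"
    using finite_expo_card by simp
  note * = lower.card_spanning_image[OF independent_mono_of fin independent_mono_of[of "expo a b i"],
      unfolded span_mono_of, OF lower_surj[OF assms]]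
  show "coeff (gauss a b) i \<le> coeff (gauss a b) (Suc i)"
    and "coeff (gauss a b) i < coeff (gauss a b) (Suc i) \<longleftrightarrow> (\<exists>p\<in>hom a b (Suc i). p \<noteq> 0 \<and> lower p = 0)"
    using * by (simp_all add: card)
qed

lemma sym_unimodal_gauss: "sym_unimodal (gauss a b)"
proof (rule sym_unimodalI)
  fix k assume k: "2 * k \<le> int (degree (gauss a b))"
  show "zcoeff (gauss a b) (k - 1) \<le> zcoeff (gauss a b) k"
  proof (cases "1 \<le> k")
    case True
    then obtain i where i: "k = int (Suc i)"
      by (metis One_nat_def Suc_le_D nonneg_int_cases of_nat_1 of_nat_le_iff order_trans zero_le_one)
    have "2 * i < a * b"
      using k by (simp add: i flip: of_nat_mult)
    then show ?thesis
      using gauss_step(1)[of i a b] zcoeff_of_nat[of "gauss a b" i] zcoeff_of_nat[of "gauss a b" "Suc i"]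
      by (simp add: i)
  qed (simp add: zcoeff_def)
qed (simp_all add: zcoeff_gauss_sym del: degree_gauss)

lemma jump_gauss_iff:
  "jump (gauss a b) (int i) \<longleftrightarrow> 2 * i \<le> a * b \<and> (\<exists>p\<in>hom a b i. p \<noteq> 0 \<and> lower p = 0)"
proof (cases i)
  case 0
  have "card (expo a b 0) = 1"
    using finite_expo_card[of a b 0] by simp
  then obtain \<alpha> where "\<alpha> \<in> expo a b 0"
    by (auto simp: card_1_singleton_iff)
  then have "mono_of \<alpha> \<in> hom a b 0" "mono_of \<alpha> \<noteq> 0"
    by (auto simp: hom_mono_of simp flip: keys_eq_empty)
  then show ?thesis
    using 0 lower_hom_0 jump_0[OF sym_unimodal_gauss] by auto
next
  case (Suc l)
  have "2 * int i \<le> int (a * b) \<longleftrightarrow> 2 * i \<le> a * b"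
    by (metis of_nat_le_iff of_nat_mult of_nat_numeral)
  then show ?thesis
    using gauss_step(2)[of l a b] zcoeff_of_nat[of "gauss a b" l] zcoeff_of_nat[of "gauss a b" "Suc l"]
    unfolding jump_def Suc by auto
qed

text \<open>The polynomial ring is a domain and the kernel of a derivation is a subring.\<close>

lemma jump_gauss_add:
  assumes "jump (gauss a b) (int i)" "jump (gauss a' b) (int i')"
  shows "jump (gauss (a + a') b) (int (i + i'))"
proof -
  obtain p q where p: "p \<in> hom a b i" "p \<noteq> 0" "lower p = 0" and q: "q \<in> hom a' b i'" "q \<noteq> 0" "lower q = 0"
    using assms jump_gauss_iff by meson
  have "p * q \<in> hom (a + a') b (i + i')" "p * q \<noteq> 0" "lower (p * q) = 0"
    using p q by (auto simp: derivation_mult intro: hom_mult)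
  moreover have "2 * (i + i') \<le> (a + a') * b"
    using assms by (simp add: jump_gauss_iff distrib_right)
  ultimately show ?thesis
    unfolding jump_gauss_iff by blast
qed

section \<open>Jumps of Gaussian polynomials\<close>

definition gauss_jump :: "nat \<Rightarrow> nat \<Rightarrow> nat \<Rightarrow> bool" where
  "gauss_jump a b i \<longleftrightarrow> jump (gauss a b) (int i)"

lemma gauss_jump_0 [simp]: "gauss_jump a b 0"
  using jump_0[OF sym_unimodal_gauss] by (simp add: gauss_jump_def)

lemma gauss_jump_commute: "gauss_jump a b i \<longleftrightarrow> gauss_jump b a i"
  by (simp add: gauss_jump_def gauss_commute)

lemma gauss_jump_add: "gauss_jump a b i \<Longrightarrow> gauss_jump a' b i' \<Longrightarrow> gauss_jump (a + a') b (i + i')"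
  unfolding gauss_jump_def by (rule jump_gauss_add)

lemma coeff_gauss_Suc:
  "coeff (gauss (Suc a) (Suc b)) i =
     coeff (gauss (Suc a) b) i + (if i < Suc b then 0 else coeff (gauss a (Suc b)) (i - Suc b))"
  by (simp add: coeff_monom_mult)

lemma gauss_jumpI:
  assumes "2 * Suc i \<le> a * b" "coeff (gauss a b) i < coeff (gauss a b) (Suc i)"
  shows "gauss_jump a b (Suc i)"
proof -
  have "2 * int (Suc i) \<le> int (a * b)"
    using assms(1) by (metis of_nat_le_iff of_nat_mult of_nat_numeral)
  then show ?thesis
    using assms(2) zcoeff_of_nat[of "gauss a b" i] zcoeff_of_nat[of "gauss a b" "Suc i"]
    unfolding gauss_jump_def jump_def by simp
qed

lemma gauss_jump_small:
  "gauss_jump 2 2 2" "gauss_jump 3 3 3" "gauss_jump 4 3 6" "gauss_jump 3 5 6" "gauss_jump 5 5 12"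
proof -
  have "gauss_jump 2 2 (Suc 1)" "gauss_jump 3 3 (Suc 2)" "gauss_jump 4 3 (Suc 5)"
    "gauss_jump 3 5 (Suc 5)" "gauss_jump 5 5 (Suc 11)"
    by (rule gauss_jumpI; simp add: numeral_eq_Suc coeff_gauss_Suc del: gauss.simps(3))+
  then show "gauss_jump 2 2 2" "gauss_jump 3 3 3" "gauss_jump 4 3 6" "gauss_jump 3 5 6" "gauss_jump 5 5 12"
    by (simp_all add: numeral_eq_Suc)
qed

definition even_jumps :: "nat \<Rightarrow> nat \<Rightarrow> bool" where
  "even_jumps a b \<longleftrightarrow> (\<forall>k. 4 * k \<le> a * b \<longrightarrow> gauss_jump a b (2 * k))"

definition dense_jumps :: "nat \<Rightarrow> nat \<Rightarrow> bool" where
  "dense_jumps a b \<longleftrightarrow> (\<forall>k. 2 * (k + 1) \<le> a * b \<longrightarrow> gauss_jump a b k \<or> gauss_jump a b (k + 1))"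

lemma even_jumps_commute: "even_jumps a b \<longleftrightarrow> even_jumps b a"
  by (simp add: even_jumps_def gauss_jump_commute[of a] mult.commute)

lemma dense_jumps_commute: "dense_jumps a b \<longleftrightarrow> dense_jumps b a"
  by (simp add: dense_jumps_def gauss_jump_commute[of a] mult.commute)

lemma gauss_jump_mono: "gauss_jump a b i \<Longrightarrow> gauss_jump (a + a') b i"
  using gauss_jump_add[of a b i a' 0] by simp

lemma even_jumps_0: "even_jumps 0 b"
  by (simp add: even_jumps_def)

lemma even_jumps_add:
  assumes "even_jumps a b" "even_jumps a' b" "4 dvd a * b"
  shows "even_jumps (a + a') b"
  unfolding even_jumps_def
proof (intro allI impI)
  fix k assume k: "4 * k \<le> (a + a') * b"
  obtain m where m: "a * b = 4 * m" using assms(3) by (elim dvdE)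
  show "gauss_jump (a + a') b (2 * k)"
  proof (cases "k \<le> m")
    case True
    then show ?thesis
      using assms(1) m by (intro gauss_jump_mono) (auto simp: even_jumps_def)
  next
    case False
    have "gauss_jump a b (2 * m)" "gauss_jump a' b (2 * (k - m))"
      using assms(1,2) m k unfolding even_jumps_def distrib_right by simp_all
    then have "gauss_jump (a + a') b (2 * m + 2 * (k - m))"
      by (rule gauss_jump_add)
    also have "2 * m + 2 * (k - m) = 2 * k" using False by simp
    finally show ?thesis .
  qed
qed

lemma even_jumps_mult:
  assumes "even_jumps a b" "4 dvd a * b"
  shows "even_jumps (n * a) b"
proof (induction n)
  case (Suc n)
  show ?case
    using even_jumps_add[OF assms(1) Suc assms(2)] by simp
qed (simp add: even_jumps_0)

lemma even_jumps_2: "even_jumps 2 b"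
  unfolding even_jumps_def
proof (intro allI impI)
  fix k assume k: "4 * k \<le> 2 * b"
  have "gauss_jump (2 * k) 2 (2 * k)"
  proof (induction k)
    case (Suc k)
    then show ?case
      using gauss_jump_add[OF gauss_jump_small(1) Suc] by simp
  qed simp
  then have "gauss_jump (2 * k + (b - 2 * k)) 2 (2 * k)"
    by (rule gauss_jump_mono)
  then show "gauss_jump 2 b (2 * k)"
    using k by (simp add: gauss_jump_commute)
qed

lemma even_jumps_even_3: "even_jumps (2 * n) 3"
proof -
  have 23: "gauss_jump 2 3 2"
    using even_jumps_2[of 3] by (auto simp: even_jumps_def dest: spec[of _ 1])
  have 43: "even_jumps 4 3"
    unfolding even_jumps_def
  proof (intro allI impI)
    fix k :: nat assume "4 * k \<le> 4 * 3"
    then consider "k = 0" | "k = 1" | "k = 2" | "k = 3" by linarith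
    then show "gauss_jump 4 3 (2 * k)"
    proof cases
      case 2
      then show ?thesis using gauss_jump_mono[OF 23, of 2] 2 by simp
    next
      case 3
      then show ?thesis using gauss_jump_add[OF 23 23] 3 by simp
    next
      case 4
      then show ?thesis using gauss_jump_small(3) by simp
    qed simp
  qed
  have 4: "even_jumps (m * 4) 3" for m
    by (rule even_jumps_mult[OF 43]) simp
  obtain m where "n = 2 * m \<or> n = 2 * m + 1"
    by (metis oddE evenE)
  then show ?thesis
  proof
    assume "n = 2 * m"
    then show ?thesis using 4[of m] by (simp add: mult.commute)
  next
    assume n: "n = 2 * m + 1"
    have "even_jumps (m * 4 + 2) 3"
      by (rule even_jumps_add[OF 4 even_jumps_2]) simp
    then show ?thesis using n by (simp add: algebra_simps)
  qed
qed

lemma even_jumps_even: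
  assumes "even b" "a \<noteq> 1"
  shows "even_jumps a b"
proof -
  have "4 dvd 2 * b" using assms(1) by auto
  have 2: "even_jumps (n * 2) b" for n
    by (rule even_jumps_mult[OF even_jumps_2]) fact
  show ?thesis
  proof (cases "even a")
    case True
    then show ?thesis using 2[of "a div 2"] by simp
  next
    case False
    then obtain m where "a = 2 * m + 1" by (elim oddE)
    with assms(2) obtain n where a: "a = n * 2 + 3"
      by (cases m) auto
    have "even_jumps 3 b"
      using assms(1) even_jumps_even_3[of "b div 2"] by (simp add: even_jumps_commute)
    moreover have "4 dvd n * 2 * b"
      using \<open>4 dvd 2 * b\<close> by (metis dvd_mult mult.assoc)
    ultimately show ?thesis
      unfolding a by (intro even_jumps_add 2)
  qed
qed

lemma dense_jumps_if_even_jumps: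
  assumes "even_jumps a b" "even (a * b)"
  shows "dense_jumps a b"
  unfolding dense_jumps_def
proof (intro allI impI)
  fix k assume k: "2 * (k + 1) \<le> a * b"
  show "gauss_jump a b k \<or> gauss_jump a b (k + 1)"
  proof (cases "even k")
    case True
    then obtain l where "k = 2 * l" by (elim evenE)
    then show ?thesis using assms k by (auto simp: even_jumps_def)
  next
    case False
    then obtain l where "k = 2 * l + 1" by (elim oddE)
    then show ?thesis
      using assms k unfolding even_jumps_def by (auto dest: spec[of _ "l + 1"])
  qed
qed

lemma dense_jumps_add_4:
  assumes "dense_jumps a b" "even_jumps 4 b" "4 \<le> a * b"
  shows "dense_jumps (a + 4) b"
  unfolding dense_jumps_def
proof (intro allI impI)
  fix k assume k: "2 * (k + 1) \<le> (a + 4) * b"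
  have ev: "gauss_jump (a + 4) b (2 * l)" if "l \<le> b" for l
    using that assms(2) gauss_jump_mono[of 4 b "2 * l" a] by (simp add: even_jumps_def add.commute)
  show "gauss_jump (a + 4) b k \<or> gauss_jump (a + 4) b (k + 1)"
  proof (cases "k < 2 * b")
    case True
    have "k = 2 * (k div 2) \<or> k + 1 = 2 * (k div 2 + 1)" by presburger
    then show ?thesis
      using ev[of "k div 2"] ev[of "k div 2 + 1"] True by auto
  next
    case False
    have "gauss_jump a b (k - 2 * b) \<or> gauss_jump a b (k - 2 * b + 1)"
      using assms(1) False k unfolding dense_jumps_def by (auto simp: algebra_simps)
    moreover have "gauss_jump 4 b (2 * b)"
      using assms(2) by (simp add: even_jumps_def)
    ultimately show ?thesis
      using gauss_jump_add[of a b _ 4 "2 * b"] False by fastforce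
  qed
qed

lemma dense_jumps_odd:
  assumes "dense_jumps a b" "2 \<le> a" "2 \<le> b"
  shows "dense_jumps (a + 4 * m) b"
proof (induction m)
  case (Suc m)
  have "even_jumps 4 b"
    using even_jumps_even[of 4 b] assms(3) by (simp add: even_jumps_commute)
  moreover have "2 * 2 \<le> (a + 4 * m) * b"
    using assms by (intro mult_mono) auto
  ultimately show ?case
    using dense_jumps_add_4[OF Suc] by (simp add: add.commute add.left_commute)
qed (use assms in simp)

lemma dense_jumps_small: "dense_jumps 3 3" "dense_jumps 3 5" "dense_jumps 5 5"
proof -
  have 2: "gauss_jump (2 + a) b (2 * k)" if "2 * k \<le> b" for a b k
    using even_jumps_2[of b] that by (intro gauss_jump_mono) (auto simp: even_jumps_def)
  have 33: "gauss_jump 3 3 2" and 35: "gauss_jump 3 5 2" "gauss_jump 3 5 4"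
    using 2[of 1 3 1] 2[of 1 5 1] 2[of 2 5 1] by simp_all
  have 5: "gauss_jump 5 5 (2 * k)" if "k \<le> 5" for k
    using even_jumps_even[of 4 5] that gauss_jump_mono[of 4 5 "2 * k" 1]
    by (auto simp: even_jumps_commute even_jumps_def)
  show "dense_jumps 3 3"
    unfolding dense_jumps_def
  proof (intro allI impI)
    fix k :: nat assume "2 * (k + 1) \<le> 3 * 3"
    then have "k = 0 \<or> k + 1 = 2 \<or> k = 2 \<or> k = 3" by presburger
    then show "gauss_jump 3 3 k \<or> gauss_jump 3 3 (k + 1)"
      using 33 gauss_jump_small(2) gauss_jump_0 by metis
  qed
  show "dense_jumps 3 5"
    unfolding dense_jumps_def
  proof (intro allI impI)
    fix k :: nat assume "2 * (k + 1) \<le> 3 * 5"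
    then have "k = 0 \<or> k + 1 = 2 \<or> k = 2 \<or> k + 1 = 4 \<or> k = 4 \<or> k + 1 = 6 \<or> k = 6" by presburger
    then show "gauss_jump 3 5 k \<or> gauss_jump 3 5 (k + 1)"
      using 35 gauss_jump_small(4) gauss_jump_0 by metis
  qed
  show "dense_jumps 5 5"
    unfolding dense_jumps_def
  proof (intro allI impI)
    fix k :: nat assume "2 * (k + 1) \<le> 5 * 5"
    then have "k = 2 * (k div 2) \<and> k div 2 \<le> 5 \<or> k + 1 = 2 * (k div 2 + 1) \<and> k div 2 + 1 \<le> 5 \<or> k = 11"
      by presburger
    then show "gauss_jump 5 5 k \<or> gauss_jump 5 5 (k + 1)"
      using 5[of "k div 2"] 5[of "k div 2 + 1"] gauss_jump_small(5) by auto
  qed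
qed

lemma dense_jumps:
  assumes "2 \<le> a" "2 \<le> b"
  shows "dense_jumps a b"
proof (cases "even (a * b)")
  case True
  then have "even_jumps a b"
    using assms even_jumps_even[of a b] even_jumps_even[of b a] by (auto simp: even_jumps_commute)
  then show ?thesis using True by (rule dense_jumps_if_even_jumps)
next
  case False
  have mod4: "\<exists>m. c = 3 + 4 * m \<or> c = 5 + 4 * m" if "odd c" "2 \<le> c" for c :: nat
    using that by presburger
  obtain m n where m: "a = 3 + 4 * m \<or> a = 5 + 4 * m" and n: "b = 3 + 4 * n \<or> b = 5 + 4 * n"
    using mod4[of a] mod4[of b] False assms by auto
  have base: "dense_jumps c d" if "c \<in> {3, 5}" "d \<in> {3, 5}" for c d
    using that dense_jumps_small dense_jumps_commute by auto
  have "dense_jumps a d" if "d \<in> {3, 5}" for d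
    using m base[of 3 d] base[of 5 d] that dense_jumps_odd[of 3 d m] dense_jumps_odd[of 5 d m] by auto
  then have "dense_jumps a 3" "dense_jumps a 5"
    by auto
  then have "dense_jumps 3 a" "dense_jumps 5 a"
    by (simp_all add: dense_jumps_commute[of a])
  then have "dense_jumps b a"
    using n assms dense_jumps_odd[of 3 a n] dense_jumps_odd[of 5 a n] by auto
  then show ?thesis by (simp add: dense_jumps_commute[of a])
qed

lemma jumps_dense_gauss:
  assumes "2 \<le> a" "2 \<le> b"
  shows "jumps_dense (gauss a b)"
  unfolding jumps_dense_def
proof (intro conjI allI impI sym_unimodal_gauss)
  fix k :: int assume k: "0 \<le> k" "2 * (k + 1) \<le> int (degree (gauss a b))"
  then obtain n where n: "k = int n"
    using nonneg_int_cases by blast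
  have "int (2 * (n + 1)) \<le> int (a * b)"
    using k(2) by (simp add: n)
  then have "2 * (n + 1) \<le> a * b"
    by (simp only: of_nat_le_iff)
  then have "gauss_jump a b n \<or> gauss_jump a b (n + 1)"
    using dense_jumps[OF assms] by (simp add: dense_jumps_def)
  then show "jump (gauss a b) k \<or> jump (gauss a b) (k + 1)"
    by (simp add: gauss_jump_def n add.commute)
qed

lemma jumps_gauss: "jumps_closed (gauss a b) \<or> jumps_dense (gauss a b)"
proof -
  consider "a = 0 \<or> b = 0" | "a = 1 \<or> b = 1" | "2 \<le> a" "2 \<le> b" by linarith
  then show ?thesis
  proof cases
    case 1
    then show ?thesis using jumps_closed_qint[of 0] by auto
  next
    case 2
    then show ?thesis
      using jumps_closed_qint gauss_1_right gauss_commute by (metis One_nat_def)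
  qed (use jumps_dense_gauss in auto)
qed

section \<open>Trees with at most one nonconstant factor\<close>

lemma plucking_neq_0 [simp]: "plucking t \<noteq> 0"
  using plucking_hooks[of t] qfact_neq_0[of "num_edges t"] by force

lemma plucking_trivial [simp]: "plucking (PNode []) = 1"
  by (simp add: plucking.simps)

lemma degree_plucking_eq_0:
  "degree (plucking t) = 0 \<Longrightarrow> underlying t = path_tree (num_edges t) \<and> plucking t = 1"
proof (induction t)
  case (PNode ts)
  show ?case
  proof (cases ts)
    case (Cons t us)
    have "degree (plucking (PNode ts)) = Suc (num_edges t) * num_edges (PNode us) + (degree (plucking t) + degree (plucking (PNode us)))"
      unfolding Cons plucking_Cons by (simp add: degree_mult_eq del: num_edges.simps)
    then have "num_edges (PNode us) = 0" "degree (plucking t) = 0"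
      using PNode.prems by auto
    moreover from this have "us = []"
      by (simp only: num_edges_eq_0_iff) simp
    ultimately show ?thesis
      using PNode.IH[of t] by (simp add: Cons plucking_Cons)
  qed simp
qed

lemma plucking_jumps_closed_or_two_paths:
  "jumps_closed (plucking t) \<or>
     (\<exists>a\<ge>1. \<exists>b\<ge>1. reduction (underlying t) = two_paths b a \<and> plucking t = gauss a b)"
proof (induction "num_edges t" arbitrary: t rule: less_induct)
  case less
  consider "t = PNode []" | s where "t = PNode [s]" | s us where "t = PNode (s # us)" "us \<noteq> []"
    by (metis ptree.exhaust list.exhaust)
  then show ?case
  proof cases
    case 1
    then show ?thesis using jumps_closed_qint[of 0] by simp
  next
    case 2
    then show ?thesis using less[of s] by (simp add: plucking_Cons)
  next
    case 3
    define a b where "a = num_edges s" and "b = num_edges (PNode us)"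
    have "b \<noteq> 0"
      using 3(2) unfolding b_def num_edges_eq_0_iff by simp
    define g where "g = gauss (Suc a) b"
    have t: "plucking t = g * plucking s * plucking (PNode us)"
      by (simp add: 3 plucking_Cons a_def b_def g_def mult.assoc del: num_edges.simps)
    have "num_edges s < num_edges t" "num_edges (PNode us) < num_edges t"
      by (simp_all add: 3)
    then have IH: "jumps_closed (plucking s) \<or> jumps_dense (plucking s)"
      "jumps_closed (plucking (PNode us)) \<or> jumps_dense (plucking (PNode us))"
      using less[of s] less[of "PNode us"] jumps_gauss by metis+
    have g: "jumps_closed g \<or> jumps_dense g" "0 < degree g"
      using jumps_gauss \<open>b \<noteq> 0\<close> by (auto simp: g_def)
    show ?thesis
    proof (cases "degree (plucking s) = 0")
      case s: True
      show ?thesis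
      proof (cases "degree (plucking (PNode us)) = 0")
        case True
        have paths: "underlying s = path_tree a" "underlying (PNode us) = path_tree b"
          and "plucking s = 1" "plucking (PNode us) = 1"
          using degree_plucking_eq_0[OF s] degree_plucking_eq_0[OF True] by (simp_all add: a_def b_def)
        then have "plucking t = gauss (Suc a) b"
          by (simp add: t g_def)
        moreover have "reduction (underlying t) = two_paths b (Suc a)"
        proof -
          obtain c where c: "b = Suc c"
            using \<open>b \<noteq> 0\<close> not0_implies_Suc by blast
          have "underlying t = RNode {#path_tree a, path_tree c#}"
            using paths by (simp add: 3 c)
          then show ?thesis
            by (simp add: c two_paths_def glue_def add_mset_commute)
        qed
        ultimately show ?thesis
          using \<open>b \<noteq> 0\<close> by (metis One_nat_def Suc_le_eq zero_less_Suc neq0_conv)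
      next
        case False
        then show ?thesis
          using jumps_closed_mult_pos_degree[OF g(1) IH(2) g(2)] degree_plucking_eq_0[OF s] by (simp add: t)
      qed
    next
      case False
      then have closed: "jumps_closed (g * plucking s)"
        using jumps_closed_mult_pos_degree[OF g(1) IH(1) g(2)] by simp
      show ?thesis
      proof (cases "degree (plucking (PNode us)) = 0")
        case True
        then show ?thesis
          using closed degree_plucking_eq_0[OF True] by (simp add: t)
      next
        case nz: False
        have "0 < degree (g * plucking s)"
          using g(2) by (subst degree_mult_eq) (auto simp: g_def)
        then show ?thesis
          using jumps_closed_mult_pos_degree[OF disjI1[OF closed] IH(2)] nz by (simp add: t)
      qed
    qed
  qed
qed

theorem corollary5p1:
  fixes T :: rtree and P :: ptree
  assumes embedding: "underlying P = T"
    and not_two_paths: "\<And>a b :: nat. 1 \<le> a \<Longrightarrow> 1 \<le> b \<Longrightarrow> reduction T \<noteq> two_paths b a"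
  shows "trapezoidal (plucking P)"
  using plucking_jumps_closed_or_two_paths[of P] jumps_closed_imp_trapezoidal assms by blast

end
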